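(* Let $\lambda=\log\frac{3+\sqrt5}{2}$ and let $G$ be the simply connected 6-dimensional solvable Lie group whose left-invariant coframe $e^1,\dots,e^6$ satisfies $de^1=-\lambda e^{15}$, $de^2=\lambda e^{25}$, $de^3=-\lambda e^{36}$, $de^4=\lambda e^{46}$, $de^5=de^6=0$, with left-invariant symplectic form $\omega=e^{12}+e^{34}+e^{56}$. Let $\varphi$ be a left-invariant primitive 3-form on $G$, written as $$\varphi=Ae^{135}+Be^{136}+Ce^{145}+De^{146}+Ee^{235}+Fe^{236}+Ge^{245}+He^{246}+(Ie^1+Je^2)(e^{34}-e^{56})+(Ke^3+Le^4)(e^{12}-e^{56})+(Me^5+Ne^6)(e^{12}-e^{34})$$ with constants $A,\dots,N$. Then: 1. $\varphi$ is integrable ($d\varphi=0$) if and only if $A=B=\alpha$, $C=-D=\beta$, $E=-F=\gamma$, $G=H=-\delta$ for some constants $\alpha,\beta,\gamma,\delta$, and $I=J=K=L=0$. 2. $\varphi$ is an integrable stationary point of the Type IIA flow $\partial_t\varphi=d\Lambda_\omega dF(\varphi)$ if and only if it is integrable and $F$-integrable ($d\varphi=0$ and $dF(\varphi)=0$). In this case $A=B=\alpha$, $C=-D=\beta$, $E=-F=\gamma$, $G=H=-\delta$, $I=J=K=L=0$, and $$\alpha(4\beta\gamma-(M-N)^2)=\delta(4\beta\gamma-(M-N)^2)=\beta(4\alpha\delta-(M+N)^2)=\gamma(4\alpha\delta-(M+N)^2)=0.$$ In particular, $Q(\varphi)=64\alpha\beta\gamma\delta\geq0$. 3. If $\varphi$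 is both integrable and $F$-integrable, then $\varphi$ lies in one of the following orbits: $\mathcal{O}_+(\mu)$ (for some $\mu>0$), $\mathcal{O}_1^\pm$, $\mathcal{O}_3\cap\bigwedge_0^3V^*$ and $\mathcal{O}_6=\{0\}$.
   Context: Notation: $e^{ij}=e^i\wedge e^j$, $e^{ijk}=e^i\wedge e^j\wedge e^k$; products such as $e^1(e^{34}-e^{56})$ are wedge products; $\Lambda_\omega$ is the Lefschetz operator of contraction with $\omega$. A 3-form is primitive if $\omega\wedge\varphi=0$; the displayed expression is the general left-invariant primitive 3-form. The coefficients $F,K$ in it are constants, not to be confused with the following: $K(\varphi)\in\mathrm{End}\,TG$ is defined by $\iota_{K(\varphi)X}\frac{\omega^3}{3!}=-\iota_X\varphi\wedge\varphi$; the 3-form $F(\varphi)$ by $F(\varphi)(X,Y,Z)=-2\varphi(K(\varphi)X,Y,Z)$; the number $Q(\varphi)$ by $\varphi\wedge F(\varphi)=-Q(\varphi)\frac{\omega^3}{3!}$. A stationary point of the flow is a $\varphi$ with $d\Lambda_\omega dF(\varphi)=0$. Let $V$ be the Lie algebra of $G$ and $\bigwedge^3_0V^*$ the space of primitive 3-forms on $V$. The relevant $\mathrm{Sp}(V,\omega)$-orbits are represented by the following normal forms, in a basis $f^i$ of $V^*$ with $\omega=f^{12}+f^{34}+f^{56}$: $\mathcal{O}_+(\mu)$: $\mu(f^{135}+f^{246})$; $\mathcal{O}_1^\pm$: $(f^{13}\mp f^{24})\wedge f^5$; $\mathcal{O}_3\cap\bigwedge_0^3V^*$: $f^{135}$;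 $\mathcal{O}_6$: $0$. *)

theory Defs
  imports "HOL-Analysis.Analysis" "HOL-Library.Function_Algebras"
begin

text \<open>
  An exterior form on \<open>'v\<close> is a function on lists of vectors; a form of degree \<open>k\<close> vanishes on
  all lists of length other than \<open>k\<close>.  The wedge product is normalised by
  \<open>(a \<and> b)(v, w) = a v * b w - a w * b v\<close> for 1-forms.  Addition, subtraction and \<open>0\<close> of forms are
  pointwise.
\<close>

type_synonym 'v form = "'v list \<Rightarrow> real"

definition is_form :: "nat \<Rightarrow> 'v::real_vector form \<Rightarrow> bool" where
  "is_form k a \<longleftrightarrow>
     (\<forall>vs. length vs \<noteq> k \<longrightarrow> a vs = 0) \<and>
     (\<forall>vs i. length vs = k \<and> i < k \<longrightarrow> linear (\<lambda>v. a (vs[i := v]))) \<and>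
     (\<forall>vs i j. length vs = k \<and> i < j \<and> j < k \<and> vs ! i = vs ! j \<longrightarrow> a vs = 0)"

definition scale_form :: "real \<Rightarrow> 'v form \<Rightarrow> 'v form" (infixr "\<cdot>" 75) where
  "c \<cdot> a = (\<lambda>vs. c * a vs)"

text \<open>
  The shuffle formula: \<open>S\<close> selects the positions of the arguments passed to \<open>a\<close>, and the exponent
  counts the inversions of the shuffle.
\<close>

definition wedge :: "'v form \<Rightarrow> 'v form \<Rightarrow> 'v form" (infixr "\<and>\<^sub>F" 72) where
  "a \<and>\<^sub>F b = (\<lambda>vs. \<Sum>S\<in>Pow {..<length vs}.
     (- 1) ^ card {(i, j). i \<in> S \<and> j \<in> {..<length vs} - S \<and> j < i}
       * a (nths vs S) * b (nths vs (- S)))"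

definition interior :: "'v \<Rightarrow> 'v form \<Rightarrow> 'v form" where
  "interior X a = (\<lambda>vs. a (X # vs))"

definition pullback :: "('u \<Rightarrow> 'v) \<Rightarrow> 'v form \<Rightarrow> 'u form" where
  "pullback g a = (\<lambda>vs. a (map g vs))"

definition one_form :: "('v \<Rightarrow> real) \<Rightarrow> 'v form" where
  "one_form f = (\<lambda>vs. case vs of [v] \<Rightarrow> f v | _ \<Rightarrow> 0)"

definition vol :: "'v form \<Rightarrow> 'v form" where
  "vol w = (1 / fact 3) \<cdot> (w \<and>\<^sub>F w \<and>\<^sub>F w)"

definition K_op :: "'v form \<Rightarrow> 'v form \<Rightarrow> 'v \<Rightarrow> 'v" where
  "K_op w p X = (THE Y. interior Y (vol w) = - (interior X p \<and>\<^sub>F p))"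

definition F_op :: "'v form \<Rightarrow> 'v form \<Rightarrow> 'v form" where
  "F_op w p = (\<lambda>vs. case vs of [X, Y, Z] \<Rightarrow> - 2 * p [K_op w p X, Y, Z] | _ \<Rightarrow> 0)"

definition Q_op :: "'v form \<Rightarrow> 'v form \<Rightarrow> real" where
  "Q_op w p = (THE q. p \<and>\<^sub>F F_op w p = - (q \<cdot> vol w))"

text \<open>
  Contraction with the bivector inverse to \<open>w\<close>.  The transposed index order in \<open>matrix_inv\<close> makes
  the contraction of \<open>w\<close> with itself equal to \<open>+n\<close> in dimension \<open>2n\<close>; for
  \<open>w = e\<^sup>1\<^sup>2 + e\<^sup>3\<^sup>4 + e\<^sup>5\<^sup>6\<close> it is \<open>a(e\<^sub>1, e\<^sub>2, \<dots>) + a(e\<^sub>3, e\<^sub>4, \<dots>) + a(e\<^sub>5, e\<^sub>6, \<dots>)\<close>.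
\<close>

definition Lefschetz :: "(real^'n) form \<Rightarrow> (real^'n) form \<Rightarrow> (real^'n) form" where
  "Lefschetz w a = (\<lambda>vs. 1 / 2 * (\<Sum>i\<in>UNIV. \<Sum>j\<in>UNIV.
     matrix_inv (\<chi> k l. w [axis k 1, axis l 1]) $ j $ i * a (axis i 1 # axis j 1 # vs)))"

definition Sp :: "'v::real_vector form \<Rightarrow> ('v \<Rightarrow> 'v) set" where
  "Sp w = {g. linear g \<and> bij g \<and> pullback g w = w}"

definition Sp_orbit :: "'v::real_vector form \<Rightarrow> 'v form \<Rightarrow> 'v form set" where
  "Sp_orbit w p = (\<lambda>g. pullback g p) ` Sp w"

text \<open>A differential form on a vector space, regarded as a manifold with the tangent space at each
  point identified with the vector space itself.\<close>

type_synonym 'v dform = "'v \<Rightarrow> 'v form"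

definition ext_d :: "'v::real_normed_vector dform \<Rightarrow> 'v dform" where
  "ext_d a = (\<lambda>x vs. \<Sum>i<length vs.
     (- 1) ^ i * frechet_derivative (\<lambda>y. a y (take i vs @ drop (Suc i) vs)) (at x) (vs ! i))"

text \<open>
  The simply connected group \<open>G\<close> is realised on \<open>real^6\<close>, with neutral element \<open>0\<close>, so that the
  tangent space at \<open>0\<close> is its Lie algebra \<open>V\<close>.  In the index type \<open>6\<close> the numerals \<open>1, \<dots>, 6\<close> are
  the six elements (with \<open>6 = 0\<close>).  In coordinates the coframe \<open>cof\<close> is
  \<open>exp (lam x\<^sub>5) dx\<^sub>1, exp (- lam x\<^sub>5) dx\<^sub>2, exp (lam x\<^sub>6) dx\<^sub>3, exp (- lam x\<^sub>6) dx\<^sub>4, dx\<^sub>5, dx\<^sub>6\<close>;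
  its invariance and structure equations are \<open>cof_left_invariant\<close> and \<open>d_cof\<close> below.
\<close>

definition lam :: real where
  "lam = ln ((3 + sqrt 5) / 2)"

definition weight :: "6 \<Rightarrow> real^6 \<Rightarrow> real" where
  "weight i x =
     (if i = 1 then lam * x $ 5 else if i = 2 then - lam * x $ 5
      else if i = 3 then lam * x $ 6 else if i = 4 then - lam * x $ 6 else 0)"

definition gmult :: "real^6 \<Rightarrow> real^6 \<Rightarrow> real^6" where
  "gmult a x = (\<chi> i. a $ i + exp (- weight i a) * x $ i)"

definition left_invariant :: "(real^6) dform \<Rightarrow> bool" where
  "left_invariant p \<longleftrightarrow>
     (\<forall>a x. pullback (frechet_derivative (gmult a) (at x)) (p (gmult a x)) = p x)"

definition cof :: "6 \<Rightarrow> (real^6) dform" where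
  "cof i x = one_form (\<lambda>v. exp (weight i x) * v $ i)"

definition cof2 :: "6 \<Rightarrow> 6 \<Rightarrow> (real^6) dform" where
  "cof2 i j x = cof i x \<and>\<^sub>F cof j x"

definition cof3 :: "6 \<Rightarrow> 6 \<Rightarrow> 6 \<Rightarrow> (real^6) dform" where
  "cof3 i j k x = cof i x \<and>\<^sub>F cof j x \<and>\<^sub>F cof k x"

definition omega :: "(real^6) dform" where
  "omega x = cof2 1 2 x + cof2 3 4 x + cof2 5 6 x"

definition primitive :: "(real^6) dform \<Rightarrow> bool" where
  "primitive p \<longleftrightarrow> (\<forall>x. omega x \<and>\<^sub>F p x = 0)"

definition F_form :: "(real^6) dform \<Rightarrow> (real^6) dform" where
  "F_form p x = F_op (omega x) (p x)"

definition Q_fun :: "(real^6) dform \<Rightarrow> real^6 \<Rightarrow> real" where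
  "Q_fun p x = Q_op (omega x) (p x)"

definition Lam :: "(real^6) dform \<Rightarrow> (real^6) dform" where
  "Lam a x = Lefschetz (omega x) (a x)"

definition integrable_form :: "(real^6) dform \<Rightarrow> bool" where
  "integrable_form p \<longleftrightarrow> ext_d p = 0"

definition F_integrable :: "(real^6) dform \<Rightarrow> bool" where
  "F_integrable p \<longleftrightarrow> ext_d (F_form p) = 0"

definition stationary :: "(real^6) dform \<Rightarrow> bool" where
  "stationary p \<longleftrightarrow> ext_d (Lam (ext_d (F_form p))) = 0"

text \<open>The basis in which the normal forms are written is the coframe at the neutral element.\<close>

definition O_plus :: "real \<Rightarrow> (real^6) form set" where
  "O_plus \<mu> = Sp_orbit (omega 0) (\<mu> \<cdot> (cof3 1 3 5 0 + cof3 2 4 6 0))"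

definition O1_plus :: "(real^6) form set" where
  "O1_plus = Sp_orbit (omega 0) ((cof2 1 3 0 - cof2 2 4 0) \<and>\<^sub>F cof 5 0)"

definition O1_minus :: "(real^6) form set" where
  "O1_minus = Sp_orbit (omega 0) ((cof2 1 3 0 + cof2 2 4 0) \<and>\<^sub>F cof 5 0)"

definition O3_prim :: "(real^6) form set" where
  "O3_prim = Sp_orbit (omega 0) (cof3 1 3 5 0)"

definition O6 :: "(real^6) form set" where
  "O6 = {0}"

lemma weight_gmult: "weight i (gmult a b) = weight i a + weight i b"
  by (auto simp: weight_def gmult_def algebra_simps)

lemma gmult_assoc: "gmult (gmult a b) c = gmult a (gmult b c)"
proof -
  have "gmult (gmult a b) c $ i = gmult a (gmult b c) $ i" for i
    by (simp add: gmult_def[of "gmult a b"] gmult_def[of a "gmult b c"] weight_gmult)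
       (simp add: gmult_def exp_add exp_diff exp_minus field_simps)
  then show ?thesis by (simp add: vec_eq_iff)
qed

lemma gmult_0_left: "gmult 0 a = a"
  by (auto simp: gmult_def weight_def vec_eq_iff)

lemma gmult_0_right: "gmult a 0 = a"
  by (auto simp: gmult_def vec_eq_iff)

lemma gmult_left_inverse: "\<exists>b. gmult b a = 0"
proof
  have "weight i (\<chi> i. - exp (weight i a) * a $ i) = - weight i a" for i
    by (auto simp: weight_def)
  then show "gmult (\<chi> i. - exp (weight i a) * a $ i) a = 0"
    by (auto simp: gmult_def vec_eq_iff)
qed

lemma gmult_derivative:
  "frechet_derivative (gmult a) (at x) = (\<lambda>v. \<chi> i. exp (- weight i a) * v $ i)"
proof -
  let ?f = "\<lambda>v::real^6. \<chi> i. exp (- weight i a) * v $ i"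
  have "linear ?f"
    by (rule linearI) (auto simp: vec_eq_iff algebra_simps)
  then have "(?f has_derivative ?f) (at x)"
    by (simp add: bounded_linear_imp_has_derivative linear_conv_bounded_linear)
  then have "((\<lambda>v. a + ?f v) has_derivative ?f) (at x)"
    by (auto intro!: derivative_eq_intros)
  moreover have "(\<lambda>v. a + ?f v) = gmult a"
    by (auto simp: gmult_def fun_eq_iff vec_eq_iff)
  ultimately have "(gmult a has_derivative ?f) (at x)"
    by simp
  then show ?thesis
    by (rule frechet_derivative_at[symmetric])
qed

lemma cof_left_invariant: "left_invariant (cof i)"
proof -
  have "pullback (frechet_derivative (gmult a) (at x)) (cof i (gmult a x)) vs = cof i x vs" for a x vs
  proof -
    have "exp (weight i (gmult a x)) * (exp (- weight i a) * r) = exp (weight i x) * r" for r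
      by (simp add: weight_gmult flip: exp_add mult.assoc)
    then show ?thesis
      by (simp add: gmult_derivative pullback_def cof_def one_form_def split: list.split)
  qed
  then show ?thesis
    unfolding left_invariant_def by blast
qed

lemma cof2_eq:
  "cof2 i j x vs = (case vs of
     [u, v] \<Rightarrow> exp (weight i x + weight j x) * (u $ i * v $ j - v $ i * u $ j) | _ \<Rightarrow> 0)"
proof (cases "length vs = 2")
  case True
  then obtain u v where vs: "vs = [u, v]"
    by (auto simp: numeral_2_eq_2 length_Suc_conv)
  define t where "t S = (- 1) ^ card {(i, j). i \<in> S \<and> j \<in> {..<length vs} - S \<and> j < i}
       * cof i x (nths vs S) * cof j x (nths vs (- S))" for S
  have P: "Pow {..<length vs} = {{}, {0}, {1}, {0, 1}}"
    by (auto simp: vs lessThan_Suc Pow_insert)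
  have ne: "{} \<noteq> {0::nat}" "{} \<noteq> {1::nat}" "{} \<noteq> {0, 1::nat}"
    "{0::nat} \<noteq> {1}" "{0::nat} \<noteq> {0, 1}" "{1::nat} \<noteq> {0, 1}"
    by auto
  have "cof2 i j x vs = (\<Sum>S\<in>{{}, {0}, {1}, {0, 1}}. t S)"
    unfolding cof2_def wedge_def t_def P ..
  also have "\<dots> = t {} + (t {0} + (t {1} + t {0, 1}))"
    using ne by simp
  finally have sum: "cof2 i j x vs = t {} + (t {0} + (t {1} + t {0, 1}))" .
  have t_triv: "t {} = 0" "t {0, 1} = 0"
    by (simp_all add: t_def vs nths_Cons cof_def one_form_def)
  have t0: "t {0} = exp (weight i x + weight j x) * (u $ i * v $ j)"
  proof -
    have "{(i, j). i \<in> {0} \<and> j \<in> {..<length vs} - {0} \<and> j < i} = ({} :: (nat \<times> nat) set)"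
      by auto
    then have "card {(i, j). i \<in> {0} \<and> j \<in> {..<length vs} - {0} \<and> j < i} = 0"
      by (metis card.empty)
    then have "t {0} = cof i x (nths vs {0}) * cof j x (nths vs (- {0}))"
      unfolding t_def by simp
    then show ?thesis by (simp add: vs nths_Cons cof_def one_form_def exp_add)
  qed
  have t1: "t {1} = - exp (weight i x + weight j x) * (v $ i * u $ j)"
  proof -
    have "{(i, j). i \<in> {1} \<and> j \<in> {..<length vs} - {1} \<and> j < i} = {(1, 0 :: nat)}"
      by (auto simp: vs)
    then have "card {(i, j). i \<in> {1} \<and> j \<in> {..<length vs} - {1} \<and> j < i} = 1"
      by simp
    then have "t {1} = - (cof i x (nths vs {1}) * cof j x (nths vs (- {1})))"
      unfolding t_def by simp
    then show ?thesis by (simp add: vs nths_Cons cof_def one_form_def exp_add)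
  qed
  show ?thesis
    unfolding sum t_triv t0 t1 by (simp add: vs algebra_simps)
next
  case False
  have "cof i x (nths vs S) * cof j x (nths vs (- S)) = 0" for S
  proof (rule ccontr)
    assume "\<not> ?thesis"
    then have "length (nths vs S) = 1" "length (nths vs (- S)) = 1"
      by (auto simp: cof_def one_form_def split: list.splits)
    moreover have "length (nths vs S) + length (nths vs (- S)) = length vs"
    proof -
      have "{k. k < length vs \<and> k \<in> S} \<union> {k. k < length vs \<and> k \<in> - S} = {..<length vs}"
        by auto
      moreover have "card ({k. k < length vs \<and> k \<in> S} \<union> {k. k < length vs \<and> k \<in> - S})
          = card {k. k < length vs \<and> k \<in> S} + card {k. k < length vs \<and> k \<in> - S}"
        by (rule card_Un_disjoint) auto
      ultimately show ?thesis by (simp add: length_nths)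
    qed
    ultimately show False using False by simp
  qed
  then have "cof2 i j x vs = 0"
    by (auto simp: cof2_def wedge_def mult.assoc intro!: sum.neutral)
  then show ?thesis using False by (auto split: list.split)
qed

lemma ext_d_cof:
  "ext_d (cof i) x vs = (case vs of
     [u, v] \<Rightarrow> exp (weight i x) * (weight i u * v $ i - weight i v * u $ i) | _ \<Rightarrow> 0)"
proof (cases "length vs = 2")
  case True
  then obtain u v where vs: "vs = [u, v]"
    by (auto simp: numeral_2_eq_2 length_Suc_conv)
  have "linear (weight i)"
    by (rule linearI) (auto simp: weight_def algebra_simps)
  then have "(weight i has_derivative weight i) (at x)"
    by (simp add: bounded_linear_imp_has_derivative linear_conv_bounded_linear)
  then have "((\<lambda>y. exp (weight i y) * c) has_derivative (\<lambda>h. exp (weight i x) * weight i h * c)) (at x)"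
    for c
    by (auto intro!: derivative_eq_intros)
  then have "frechet_derivative (\<lambda>y. exp (weight i y) * c) (at x)
      = (\<lambda>h. exp (weight i x) * weight i h * c)" for c
    by (rule frechet_derivative_at[symmetric])
  then show ?thesis
    by (simp add: vs ext_d_def cof_def one_form_def algebra_simps)
next
  case False
  have "cof i y (take k vs @ drop (Suc k) vs) = 0" if "k < length vs" for k y
  proof -
    have "length (take k vs @ drop (Suc k) vs) \<noteq> 1" using that False by auto
    moreover have "cof i y us = 0" if "length us \<noteq> 1" for us
      using that by (auto simp: cof_def one_form_def split: list.split)
    ultimately show ?thesis by blast
  qed
  then have "ext_d (cof i) x vs = 0"
    by (auto simp: ext_d_def intro!: sum.neutral)
  then show ?thesis using False by (auto split: list.split)
qed

lemma d_cof:
  "ext_d (cof 1) = (\<lambda>x. (- lam) \<cdot> cof2 1 5 x)"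
  "ext_d (cof 2) = (\<lambda>x. lam \<cdot> cof2 2 5 x)"
  "ext_d (cof 3) = (\<lambda>x. (- lam) \<cdot> cof2 3 6 x)"
  "ext_d (cof 4) = (\<lambda>x. lam \<cdot> cof2 4 6 x)"
  "ext_d (cof 5) = 0"
  "ext_d (cof 6) = 0"
  by (auto simp: fun_eq_iff ext_d_cof scale_form_def cof2_eq weight_def algebra_simps
      split: list.split)

end

theory Submission
  imports Defs
begin

text \<open>
  The form \<open>\<omega>\<close> is left-invariant and has constant coefficients, and in the coframe \<open>e\<^sup>i\<close> every
  left-invariant form is a combination of monomials with constant coefficients, so the statement is one
  about the Lie algebra.  Its shape becomes visible in a second symplectic coframe, which replaces
  \<open>e\<^sup>5, e\<^sup>6\<close> by \<open>f\<^sup>5 = e\<^sup>5 + e\<^sup>6\<close> and \<open>f\<^sup>6 = (e\<^sup>6 - e\<^sup>5) / 2\<close>: exterior differentiation is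
  wedging with \<open>\<lambda> f\<^sup>5, - \<lambda> f\<^sup>5, - 2 \<lambda> f\<^sup>6, 2 \<lambda> f\<^sup>6\<close> on \<open>e\<^sup>1\<^sup>3, e\<^sup>2\<^sup>4, e\<^sup>1\<^sup>4, e\<^sup>2\<^sup>3\<close> respectively, and it kills
  \<open>e\<^sup>1\<^sup>2, e\<^sup>3\<^sup>4, f\<^sup>5, f\<^sup>6\<close>.  Hence a primitive form is closed exactly if it is \<open>\<sigma> f\<^sup>5 + \<tau> f\<^sup>6\<close> with
  \<open>\<sigma> = a e\<^sup>1\<^sup>3 + d e\<^sup>2\<^sup>4 + p (e\<^sup>1\<^sup>2 - e\<^sup>3\<^sup>4)\<close> and \<open>\<tau> = b e\<^sup>1\<^sup>4 + c e\<^sup>2\<^sup>3 + q (e\<^sup>1\<^sup>2 - e\<^sup>3\<^sup>4)\<close>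
  (\<open>integrable_general_form\<close>, \<open>closed_general_form\<close>).

  Let \<open>s = a d + p\<^sup>2\<close>, \<open>t = b c - q\<^sup>2\<close> and \<open>m = p q\<close>, so that \<open>\<sigma>\<^sup>2, \<tau>\<^sup>2, \<sigma> \<tau>\<close> are \<open>- 2 s, 2 t, - 2 m\<close> times
  \<open>e\<^sup>1\<^sup>2\<^sup>3\<^sup>4\<close>.  The form \<open>F(\<phi>)\<close> of such a \<open>\<phi>\<close> is \<open>4 ((s \<tau> - m \<sigma>) f\<^sup>5 + (t \<sigma> + m \<tau>) f\<^sup>6)\<close>
  (\<open>F_op_two_plane\<close>).  The terms with \<open>m\<close> are closed like \<open>\<phi>\<close> itself; the others pair the
  monomials of \<open>\<sigma>\<close> and \<open>\<tau>\<close> with the wrong factor, so \<open>dF(\<phi>)\<close> has coefficients proportional to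
  \<open>s b, s c, t a, t d\<close>.  All its terms contain \<open>f\<^sup>5\<^sup>6\<close>.  Contraction with \<open>\<omega>\<close> just removes this
  factor, after which differentiation multiplies each term by \<open>f\<^sup>5\<close> or \<open>f\<^sup>6\<close> and so loses no coefficient.  That is why
  \<open>d\<Lambda>dF(\<phi>) = 0\<close> forces \<open>dF(\<phi>) = 0\<close> (\<open>F_integrable_iff\<close>, \<open>stationary_iff\<close>), and the four
  products are the four equations of the proposition.  They also simplify \<open>Q(\<phi>) = 16 (m\<^sup>2 + s t)\<close>.

  For the orbits (\<open>two_plane_normal\<close>), the equations leave two possibilities.  Either \<open>\<phi>\<close> is a
  product \<open>\<sigma>' \<and> u\<close> of a primitive 2-form in \<open>e\<^sup>1, \<dots>, e\<^sup>4\<close> with a 1-form \<open>u\<close> in \<open>e\<^sup>5, e\<^sup>6\<close>; the sign of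
  \<open>\<sigma>'\<^sup>2\<close> then decides between \<open>O\<^sub>1\<^sup>+, O\<^sub>1\<^sup>-\<close> and \<open>O\<^sub>3\<close>, unless \<open>\<phi>\<close> vanishes.  Or \<open>\<sigma>\<close> and \<open>\<tau>\<close> are both nonzero with
  square zero, hence decomposable, and \<open>\<phi>\<close> is a sum of two decomposable forms.  If these are transverse
  then \<open>\<phi>\<close> lies in \<open>O\<^sub>+\<close>, otherwise they share a factor and \<open>\<phi>\<close> is of type \<open>O\<^sub>1\<^sup>\<plusminus>\<close>.  In each case
  the normal form is reached by an explicit symplectic coframe.
\<close>

section \<open>Exterior algebra from the shuffle product\<close>

lemma wedge_Nil: "(a \<and>\<^sub>F b) [] = a [] * b []"
  by (simp add: wedge_def)

text \<open>
  The grading involution.  It records the sign \<open>(- 1)\<^sup>k\<close> that a form of degree \<open>k\<close> contributes to the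
  product rule for the interior product, without fixing a degree.
\<close>

definition twist :: "'v form \<Rightarrow> 'v form" where
  "twist a = (\<lambda>vs. (- 1) ^ length vs * a vs)"

text \<open>
  The positions chosen on a list with a new head arise from positions in the tail by a shift.  If the head
  goes to the second factor, every position chosen for the first factor gains one inversion; if it goes to the first
  factor, none is gained.
\<close>

lemma card_inversions_Suc:
  fixes S :: "nat set"
  assumes "S \<subseteq> {..<n}"
  shows "card {(i, j). i \<in> Suc ` S \<and> j \<in> {..<Suc n} - Suc ` S \<and> j < i}
      = card {(i, j). i \<in> S \<and> j \<in> {..<n} - S \<and> j < i} + card S" (is "card ?L = card ?R + _")
    and "card {(i, j). i \<in> insert 0 (Suc ` S) \<and> j \<in> {..<Suc n} - insert 0 (Suc ` S) \<and> j < i}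
      = card {(i, j). i \<in> S \<and> j \<in> {..<n} - S \<and> j < i}" (is "card ?M = _")
proof -
  have fin: "finite S" using assms finite_subset by blast
  have finR: "finite ?R"
    by (rule finite_subset[of _ "S \<times> {..<n}"]) (use fin in auto)
  have shift: "?M = map_prod Suc Suc ` ?R"
  proof (intro equalityI subsetI)
    fix z assume "z \<in> ?M"
    then obtain i j where z: "z = (i, j)"
      and *: "i \<in> insert 0 (Suc ` S)" "j < Suc n" "j \<noteq> 0" "j \<notin> Suc ` S" "j < i" by auto
    then obtain i' j' where "i = Suc i'" "j = Suc j'" "i' \<in> S"
      by (metis imageE insertE not0_implies_Suc not_less0)
    then show "z \<in> map_prod Suc Suc ` ?R" using * z by (auto intro!: rev_image_eqI[of "(i', j')"])
  qed auto
  then show "card ?M = card ?R"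
    by (simp add: card_image prod.inj_map inj_on_subset[OF prod.inj_map[OF inj_Suc inj_Suc]])
  have "?L = map_prod Suc Suc ` ?R \<union> (\<lambda>i. (Suc i, 0)) ` S"
    unfolding shift[symmetric] by (auto simp: image_iff)
  moreover have "map_prod Suc Suc ` ?R \<inter> (\<lambda>i. (Suc i, 0)) ` S = {}" by auto
  ultimately have "card ?L = card (map_prod Suc Suc ` ?R) + card ((\<lambda>i. (Suc i, 0::nat)) ` S)"
    using finR fin by (simp add: card_Un_disjoint)
  then show "card ?L = card ?R + card S"
    by (simp add: card_image inj_on_def inj_on_subset[OF prod.inj_map[OF inj_Suc inj_Suc]])
qed

text \<open>
  Peeling off the first argument: it goes either to the first factor or to the second, and in the
  second case it moves past all arguments of the first factor.  The algebraic laws of the wedge product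
  follow by induction on the list of arguments, as both sides obey the same recursion.
\<close>

lemma wedge_Cons:
  "(a \<and>\<^sub>F b) (v # vs) = (interior v a \<and>\<^sub>F b) vs + (twist a \<and>\<^sub>F interior v b) vs"
proof -
  let ?n = "length vs"
  define t where "t a b vs S = (- 1) ^ card {(i, j). i \<in> S \<and> j \<in> {..<length vs} - S \<and> j < i}
       * a (nths vs S) * b (nths vs (- S))" for a b :: "'a form" and vs and S :: "nat set"
  have w: "(a \<and>\<^sub>F b) vs = sum (t a b vs) (Pow {..<length vs})" for a b :: "'a form" and vs
    by (simp add: wedge_def t_def)
  let ?P = "Pow {..<?n}"
  have inj: "inj_on ((`) Suc) ?P"
    by (simp add: inj_on_def inj_image_eq_iff)
  have inj0: "inj_on (insert 0 \<circ> (`) Suc) ?P"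
  proof (rule inj_onI)
    fix S T :: "nat set" assume "(insert 0 \<circ> (`) Suc) S = (insert 0 \<circ> (`) Suc) T"
    then have "Suc ` S = Suc ` T" by (auto simp: set_eq_iff image_iff)
    then show "S = T" by (simp add: inj_image_eq_iff)
  qed
  have P: "Pow {..<Suc ?n} = (`) Suc ` ?P \<union> (insert 0 \<circ> (`) Suc) ` ?P"
    by (simp add: lessThan_Suc_eq_insert_0 Pow_insert image_Pow_surj[OF refl, symmetric] image_image)
  have dis: "(`) Suc ` ?P \<inter> (insert 0 \<circ> (`) Suc) ` ?P = {}" by auto
  have "(a \<and>\<^sub>F b) (v # vs) = sum (t a b (v # vs)) (Pow {..<Suc ?n})" by (simp add: w)
  also have "\<dots> = (\<Sum>S\<in>?P. t a b (v # vs) (Suc ` S)) + (\<Sum>S\<in>?P. t a b (v # vs) (insert 0 (Suc ` S)))"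
    unfolding P using dis inj inj0 by (subst sum.union_disjoint) (simp_all add: sum.reindex del: comp_apply, simp add: comp_def)
  also have "(\<Sum>S\<in>?P. t a b (v # vs) (Suc ` S)) = (twist a \<and>\<^sub>F interior v b) vs"
    unfolding w
  proof (rule sum.cong)
    fix S assume S: "S \<in> ?P"
    then have "length (nths vs S) = card S"
      by (auto simp: length_nths intro!: arg_cong[where f=card])
    moreover have "{j. Suc j \<in> - Suc ` S} = - S" "{j. Suc j \<in> Suc ` S} = S" by auto
    ultimately show "t a b (v # vs) (Suc ` S) = t (twist a) (interior v b) vs S"
      using S card_inversions_Suc(1)[of S ?n]
      by (simp add: t_def twist_def interior_def nths_Cons power_add image_iff)
  qed simp
  also have "(\<Sum>S\<in>?P. t a b (v # vs) (insert 0 (Suc ` S))) = (interior v a \<and>\<^sub>F b) vs"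
    unfolding w
  proof (rule sum.cong)
    fix S assume S: "S \<in> ?P"
    have "{j. Suc j \<in> - insert 0 (Suc ` S)} = - S" "{j. Suc j \<in> insert 0 (Suc ` S)} = S" by auto
    then show "t a b (v # vs) (insert 0 (Suc ` S)) = t (interior v a) b vs S"
      using S card_inversions_Suc(2)[of S ?n]
      by (simp add: t_def twist_def interior_def nths_Cons image_iff)
  qed simp
  finally show ?thesis by simp
qed

lemma form_eqI:
  assumes "a [] = b []" and "\<And>v. interior v a = interior v b"
  shows "a = (b :: 'v form)"
proof
  fix vs show "a vs = b vs"
    using assms by (cases vs) (auto simp: interior_def fun_eq_iff)
qed

lemma interior_wedge:
  "interior v (a \<and>\<^sub>F b) = interior v a \<and>\<^sub>F b + twist a \<and>\<^sub>F interior v b"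
  by (simp add: fun_eq_iff wedge_Cons interior_def[of _ "_ \<and>\<^sub>F _"])

lemma interior_linear:
  "interior v (a + b) = interior v a + interior v b"
  "interior v (a - b) = interior v a - interior v b"
  "interior v (- a) = - interior v a"
  "interior v (c \<cdot> a) = c \<cdot> interior v a"
  "interior v 0 = 0"
  by (auto simp: interior_def scale_form_def)

lemma wedge_linear:
  "(a + b) \<and>\<^sub>F c = a \<and>\<^sub>F c + b \<and>\<^sub>F c"
  "(a - b) \<and>\<^sub>F c = a \<and>\<^sub>F c - b \<and>\<^sub>F c"
  "(- a) \<and>\<^sub>F c = - (a \<and>\<^sub>F c)"
  "(r \<cdot> a) \<and>\<^sub>F c = r \<cdot> (a \<and>\<^sub>F c)"
  "0 \<and>\<^sub>F c = 0"
  "c \<and>\<^sub>F (a + b) = c \<and>\<^sub>F a + c \<and>\<^sub>F b"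
  "c \<and>\<^sub>F (a - b) = c \<and>\<^sub>F a - c \<and>\<^sub>F b"
  "c \<and>\<^sub>F (- a) = - (c \<and>\<^sub>F a)"
  "c \<and>\<^sub>F (r \<cdot> a) = r \<cdot> (c \<and>\<^sub>F a)"
  "c \<and>\<^sub>F 0 = 0"
  by (auto simp: fun_eq_iff wedge_def scale_form_def algebra_simps sum.distrib sum_subtractf
      sum_negf sum_distrib_left)

lemma interior_twist: "interior v (twist a) = - twist (interior v a)"
  by (auto simp: interior_def twist_def)

lemma twist_linear: "twist (a + b) = twist a + twist b"
  by (auto simp: twist_def algebra_simps)

lemma twist_twist: "twist (twist a) = a"
  by (auto simp: twist_def simp flip: mult.assoc power_add)

lemma twist_wedge: "twist (a \<and>\<^sub>F b) = twist a \<and>\<^sub>F twist b"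
proof
  show "twist (a \<and>\<^sub>F b) vs = (twist a \<and>\<^sub>F twist b) vs" for vs
  proof (induction vs arbitrary: a b)
    case Nil
    then show ?case by (simp add: twist_def wedge_Nil)
  next
    case (Cons v vs)
    have "twist (a \<and>\<^sub>F b) (v # vs) = - twist (interior v (a \<and>\<^sub>F b)) vs"
      by (simp add: twist_def interior_def)
    then show ?case
      by (simp add: wedge_Cons interior_wedge interior_twist twist_linear Cons.IH wedge_linear twist_twist)
  qed
qed

lemma wedge_assoc: "(a \<and>\<^sub>F b) \<and>\<^sub>F c = a \<and>\<^sub>F b \<and>\<^sub>F c"
proof
  show "((a \<and>\<^sub>F b) \<and>\<^sub>F c) vs = (a \<and>\<^sub>F b \<and>\<^sub>F c) vs" for vs
  proof (induction vs arbitrary: a b c)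
    case Nil
    then show ?case by (simp add: wedge_Nil)
  next
    case (Cons v vs)
    then show ?case
      by (simp add: wedge_Cons interior_wedge wedge_linear twist_wedge)
  qed
qed

definition unit_form :: "'v form" where
  "unit_form = (\<lambda>vs. if vs = [] then 1 else 0)"

lemma interior_unit: "interior v unit_form = 0"
  by (auto simp: interior_def unit_form_def)

lemma twist_unit: "twist unit_form = unit_form"
  by (auto simp: twist_def unit_form_def)

lemma wedge_unit: "unit_form \<and>\<^sub>F a = a" "a \<and>\<^sub>F unit_form = a"
proof -
  show "unit_form \<and>\<^sub>F a = a"
  proof
    show "(unit_form \<and>\<^sub>F a) vs = a vs" for vs
      by (induction vs arbitrary: a)
        (simp_all add: wedge_Nil wedge_Cons interior_unit twist_unit wedge_linear, simp_all add: unit_form_def interior_def)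
  qed
  show "a \<and>\<^sub>F unit_form = a"
  proof
    show "(a \<and>\<^sub>F unit_form) vs = a vs" for vs
      by (induction vs arbitrary: a)
        (simp_all add: wedge_Nil wedge_Cons interior_unit wedge_linear, simp_all add: unit_form_def interior_def)
  qed
qed

lemma interior_one_form: "is_form 1 a \<Longrightarrow> interior v a = a [v] \<cdot> unit_form"
  by (auto simp: is_form_def interior_def unit_form_def scale_form_def)

lemma twist_one_form: "is_form 1 a \<Longrightarrow> twist a = - a"
proof
  fix vs assume "is_form 1 a"
  then show "twist a vs = (- a) vs"
    by (cases "length vs = 1") (auto simp: is_form_def twist_def)
qed

text \<open>
  This instance of graded commutativity is what sorts products of 1-forms.
\<close>

lemma one_form_wedge: "is_form 1 a \<Longrightarrow> a \<and>\<^sub>F b = twist b \<and>\<^sub>F a"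
proof
  fix vs assume a: "is_form 1 a"
  then have a0: "a [] = 0" by (simp add: is_form_def)
  show "(a \<and>\<^sub>F b) vs = (twist b \<and>\<^sub>F a) vs"
  proof (induction vs arbitrary: b)
    case Nil
    then show ?case by (simp add: wedge_Nil a0)
  next
    case (Cons v vs)
    then show ?case
      by (simp add: wedge_Cons interior_one_form[OF a] wedge_linear wedge_unit twist_one_form[OF a]
          interior_twist twist_twist)
  qed
qed

lemma one_form_anticommute: "is_form 1 a \<Longrightarrow> is_form 1 b \<Longrightarrow> a \<and>\<^sub>F b = - (b \<and>\<^sub>F a)"
  by (simp add: one_form_wedge[of a] twist_one_form wedge_linear)

lemma one_form_square: "is_form 1 a \<Longrightarrow> a \<and>\<^sub>F a = 0"
  using one_form_anticommute[of a a] by (auto simp: fun_eq_iff)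

text \<open>
  Unrolling the recursion for a first factor of degree one gives Laplace expansion, which has the same
  shape as the formula that defines the exterior derivative.
\<close>

lemma one_form_wedge_apply:
  assumes "is_form 1 a"
  shows "(a \<and>\<^sub>F b) vs = (\<Sum>i<length vs. (- 1) ^ i * a [vs ! i] * b (take i vs @ drop (Suc i) vs))"
proof (induction vs arbitrary: b)
  case Nil
  then show ?case using assms by (simp add: wedge_Nil is_form_def)
next
  case (Cons v vs)
  have "(a \<and>\<^sub>F b) (v # vs) = a [v] * b vs - (a \<and>\<^sub>F interior v b) vs"
    using assms by (simp add: wedge_Cons interior_one_form twist_one_form wedge_linear wedge_unit)
      (simp add: scale_form_def)
  then show ?case
    by (simp add: Cons.IH sum.lessThan_Suc_shift interior_def sum_negf del: sum.lessThan_Suc)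
qed

lemma is_form_1_linear:
  "is_form 1 a \<Longrightarrow> is_form 1 b \<Longrightarrow> is_form 1 (a + b)"
  "is_form 1 a \<Longrightarrow> is_form 1 b \<Longrightarrow> is_form 1 (a - b)"
  "is_form 1 a \<Longrightarrow> is_form 1 (- a)"
  "is_form 1 a \<Longrightarrow> is_form 1 (c \<cdot> a)"
  unfolding is_form_def
  by (auto simp: scale_form_def linear_compose_add linear_compose_sub linear_compose_neg
      intro: linear_compose_scale_right[where 'b=real, simplified])

section \<open>Symplectic coframes and the operators of a 3-form\<close>

lemma exhaust_6: "x = 1 \<or> x = 2 \<or> x = 3 \<or> x = 4 \<or> x = 5 \<or> x = 6" for x :: 6
proof (induct x)
  case (of_int z)
  then have "z = 0 \<or> z = 1 \<or> z = 2 \<or> z = 3 \<or> z = 4 \<or> z = 5" by (simp, presburger)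
  then show ?case by (elim disjE) simp_all
qed

lemma forall_6: "(\<forall>i::6. P i) \<longleftrightarrow> P 1 \<and> P 2 \<and> P 3 \<and> P 4 \<and> P 5 \<and> P 6"
proof safe
  fix i :: 6
  assume "P 1" "P 2" "P 3" "P 4" "P 5" "P 6"
  then show "P i" using exhaust_6[of i] by (elim disjE) simp_all
qed blast+

lemma UNIV_6: "UNIV = {1, 2, 3, 4, 5, 6::6}"
  using exhaust_6 by (simp add: set_eq_iff)

lemma sum_6: "sum g (UNIV :: 6 set) = g 1 + g 2 + g 3 + g 4 + g 5 + g 6"
  unfolding UNIV_6 by (simp add: ac_simps)

lemma is_form_1_apply_linear: "is_form 1 a \<Longrightarrow> linear (\<lambda>v. a [v])"
proof -
  assume "is_form 1 a"
  then have "linear (\<lambda>v. a ([0][0 := v]))" unfolding is_form_def by (metis length_Cons list.size(3) One_nat_def zero_less_one)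
  then show ?thesis by simp
qed

lemma wedge_one_form_homogeneous:
  assumes "is_form 1 a" and "\<And>vs. length vs \<noteq> k \<Longrightarrow> b vs = 0" and "length vs \<noteq> Suc k"
  shows "(a \<and>\<^sub>F b) vs = 0"
  unfolding one_form_wedge_apply[OF assms(1)]
proof (rule sum.neutral, rule ballI)
  fix i assume "i \<in> {..<length vs}"
  then have "length (take i vs @ drop (Suc i) vs) \<noteq> k" using assms(3) by auto
  then show "(- 1) ^ i * a [vs ! i] * b (take i vs @ drop (Suc i) vs) = 0" using assms(2) by simp
qed
lemma scale_linear:
  "c \<cdot> (a + b) = c \<cdot> a + c \<cdot> b"
  "c \<cdot> (a - b) = c \<cdot> a - c \<cdot> b"
  "c \<cdot> (- a) = - (c \<cdot> a)"
  "c \<cdot> 0 = 0"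
  "0 \<cdot> a = 0"
  "1 \<cdot> a = a"
  "c \<cdot> c' \<cdot> a = (c * c') \<cdot> a"
  by (auto simp: fun_eq_iff scale_form_def algebra_simps)

lemma numeral_form: "numeral n * a = (numeral n :: real) \<cdot> a" for a :: "'v form"
  by (simp add: fun_eq_iff scale_form_def)

text \<open>
  Numbering a family of 1-forms by \<open>nat\<close> rather than by the type \<open>6\<close> makes the order of
  the indices decidable by rewriting; so \<open>expand\<close> below brings every form built from the family to a
  combination of monomials with increasing indices, after which identities are compared coefficientwise.
\<close>

locale one_forms =
  fixes f :: "nat \<Rightarrow> 'v::real_vector form"
  assumes one: "is_form 1 (f i)"
begin

lemma reorder:
  "i < j \<Longrightarrow> f j \<and>\<^sub>F f i = - (f i \<and>\<^sub>F f j)"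
  "i < j \<Longrightarrow> f j \<and>\<^sub>F f i \<and>\<^sub>F r = - (f i \<and>\<^sub>F f j \<and>\<^sub>F r)"
  "f i \<and>\<^sub>F f i = 0"
  "f i \<and>\<^sub>F f i \<and>\<^sub>F r = 0"
proof -
  show *: "f j \<and>\<^sub>F f i = - (f i \<and>\<^sub>F f j)" for i j
    by (rule one_form_anticommute[OF one one])
  show **: "f i \<and>\<^sub>F f i = 0" for i
    by (rule one_form_square[OF one])
  show "f j \<and>\<^sub>F f i \<and>\<^sub>F r = - (f i \<and>\<^sub>F f j \<and>\<^sub>F r)"
    using arg_cong[OF *[of j i], of "\<lambda>a. a \<and>\<^sub>F r"] by (simp add: wedge_assoc wedge_linear)
  show "f i \<and>\<^sub>F f i \<and>\<^sub>F r = 0"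
    using arg_cong[OF **[of i], of "\<lambda>a. a \<and>\<^sub>F r"] by (simp add: wedge_assoc wedge_linear)
qed

lemma interior_monomial:
  "interior v (f i \<and>\<^sub>F f j) = f i [v] \<cdot> f j - f j [v] \<cdot> f i"
  "interior v (f i \<and>\<^sub>F f j \<and>\<^sub>F r) = f i [v] \<cdot> (f j \<and>\<^sub>F r) - f i \<and>\<^sub>F interior v (f j \<and>\<^sub>F r)"
  using one by (simp_all add: interior_wedge interior_one_form twist_one_form wedge_linear wedge_unit scale_linear)

lemmas expand = numeral_form scale_linear wedge_linear wedge_assoc reorder interior_linear interior_monomial

lemma monomial_Nil: "(f i \<and>\<^sub>F r) [] = 0"
  using one[of i] by (simp add: wedge_Nil is_form_def)

lemma monomial3_homogeneous: "length vs \<noteq> 3 \<Longrightarrow> (f i \<and>\<^sub>F f j \<and>\<^sub>F f k) vs = 0"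
  by (rule wedge_one_form_homogeneous[OF one wedge_one_form_homogeneous[OF one, of 1]])
     (use one in \<open>auto simp: is_form_def\<close>)

text \<open>
  The form \<open>\<sigma> \<and> f\<^sup>5 + \<tau> \<and> f\<^sup>6\<close> for two primitive 2-forms \<open>\<sigma>, \<tau>\<close> on the 4-dimensional part,
  with \<open>\<sigma>\<close> in the span of \<open>f\<^sup>1\<^sup>3, f\<^sup>2\<^sup>4, f\<^sup>1\<^sup>2 - f\<^sup>3\<^sup>4\<close> and \<open>\<tau>\<close> in that of \<open>f\<^sup>1\<^sup>4, f\<^sup>2\<^sup>3, f\<^sup>1\<^sup>2 - f\<^sup>3\<^sup>4\<close>.
\<close>

definition two_plane_form :: "real \<Rightarrow> real \<Rightarrow> real \<Rightarrow> real \<Rightarrow> real \<Rightarrow> real \<Rightarrow> 'v form" where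
  "two_plane_form a d p b c q =
     a \<cdot> (f 1 \<and>\<^sub>F f 3 \<and>\<^sub>F f 5) + d \<cdot> (f 2 \<and>\<^sub>F f 4 \<and>\<^sub>F f 5)
     + p \<cdot> (f 1 \<and>\<^sub>F f 2 \<and>\<^sub>F f 5 - f 3 \<and>\<^sub>F f 4 \<and>\<^sub>F f 5)
     + b \<cdot> (f 1 \<and>\<^sub>F f 4 \<and>\<^sub>F f 6) + c \<cdot> (f 2 \<and>\<^sub>F f 3 \<and>\<^sub>F f 6)
     + q \<cdot> (f 1 \<and>\<^sub>F f 2 \<and>\<^sub>F f 6 - f 3 \<and>\<^sub>F f 4 \<and>\<^sub>F f 6)"

end

text \<open>
  \<open>F_op\<close> is defined by its values on triples; the assumption makes the values on lists of other lengths
  agree as well.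
\<close>

lemma interior_F_op:
  assumes "\<And>vs. length vs \<noteq> 3 \<Longrightarrow> p vs = 0"
  shows "interior v (F_op w p) = (- 2) \<cdot> interior (K_op w p v) p"
proof
  fix vs :: "'a list"
  consider y z where "vs = [y, z]" | "length vs \<noteq> 2"
    by (auto simp: numeral_2_eq_2 length_Suc_conv)
  then show "interior v (F_op w p) vs = ((- 2) \<cdot> interior (K_op w p v) p) vs"
  proof cases
    case 2
    then have "length (K_op w p v # vs) \<noteq> 3" by simp
    then have "p (K_op w p v # vs) = 0" by (rule assms)
    then show ?thesis using 2
      by (auto simp: interior_def F_op_def scale_form_def split: list.split)
  qed (simp add: interior_def F_op_def scale_form_def)
qed

lemma cof2_0: "cof2 i j 0 [u, v] = u $ i * v $ j - v $ i * u $ j"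
  by (simp add: cof2_eq weight_def)

lemma omega_0_apply:
  "omega 0 [u, v] = u $ 1 * v $ 2 - v $ 1 * u $ 2 + (u $ 3 * v $ 4 - v $ 3 * u $ 4)
      + (u $ 5 * v $ 6 - v $ 5 * u $ 6)"
  by (simp add: omega_def cof2_0)

text \<open>
  The type \<open>6\<close> represents its last index by \<open>0\<close>, so the translation to positions in a coframe is spelled
  out.
\<close>

definition coord_index :: "6 \<Rightarrow> nat" where
  "coord_index k = (if k = 1 then 1 else if k = 2 then 2 else if k = 3 then 3
     else if k = 4 then 4 else if k = 5 then 5 else 6)"

text \<open>
  The nondegeneracy of \<open>\<omega>\<close> makes the six 1-forms independent
  (\<open>inj_coord\<close>), and the map \<open>coord\<close> that they form is then an element of the symplectic group which pulls
  the standard coframe back to them.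
\<close>

locale symplectic_coframe = one_forms f for f :: "nat \<Rightarrow> (real^6) form" +
  assumes symplectic: "f 1 \<and>\<^sub>F f 2 + f 3 \<and>\<^sub>F f 4 + f 5 \<and>\<^sub>F f 6 = omega 0"
begin

definition coord :: "real^6 \<Rightarrow> real^6" where
  "coord v = (\<chi> k. f (coord_index k) [v])"

lemma coord_nth:
  "coord v $ 1 = f 1 [v]" "coord v $ 2 = f 2 [v]" "coord v $ 3 = f 3 [v]"
  "coord v $ 4 = f 4 [v]" "coord v $ 5 = f 5 [v]" "coord v $ 6 = f 6 [v]"
  by (simp_all add: coord_def coord_index_def)

lemma linear_coord: "linear coord"
proof (rule linearI)
  note lin = is_form_1_apply_linear[OF one]
  show "coord (u + v) = coord u + coord v" for u v
    by (simp add: vec_eq_iff coord_def linear_add[OF lin])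
  show "coord (c *\<^sub>R v) = c *\<^sub>R coord v" for c v
    by (simp add: vec_eq_iff coord_def linear_cmul[OF lin])
qed

lemma inj_coord: "inj coord"
proof (rule injI)
  fix u v assume "coord u = coord v"
  then have "coord (u - v) = 0" by (simp add: linear_diff[OF linear_coord])
  then have "f k [u - v] = 0" if "k \<in> {1, 2, 3, 4, 5, 6}" for k
    using that coord_nth[of "u - v"] by auto
  then have "interior (u - v) (omega 0) = 0"
    unfolding symplectic[symmetric] by (simp add: expand)
  then have "omega 0 [u - v, w] = 0" for w
    by (auto simp: interior_def fun_eq_iff)
  note this[of "axis 1 1"] this[of "axis 2 1"] this[of "axis 3 1"] this[of "axis 4 1"]
    this[of "axis 5 1"] this[of "axis 6 1"]
  then have "\<forall>k. (u - v) $ k = 0"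
    by (simp add: omega_0_apply axis_def forall_6)
  then show "u = v" by (simp add: vec_eq_iff)
qed

lemma bij_coord: "bij coord"
  by (simp add: bij_def inj_coord linear_injective_imp_surjective[OF linear_coord inj_coord])

lemma ex_coord:
  "\<exists>v. f 1 [v] = c1 \<and> f 2 [v] = c2 \<and> f 3 [v] = c3 \<and> f 4 [v] = c4 \<and> f 5 [v] = c5 \<and> f 6 [v] = c6"
proof -
  obtain v where "(\<chi> k. if k = 1 then c1 else if k = 2 then c2 else if k = 3 then c3
     else if k = 4 then c4 else if k = 5 then c5 else c6) = coord v"
    by (rule surjE[OF bij_is_surj[OF bij_coord]])
  from this[symmetric] show ?thesis
    by (intro exI[of _ v]) (simp add: coord_nth[symmetric, unfolded One_nat_def])
qed

lemma volume: "vol (omega 0) = f 1 \<and>\<^sub>F f 2 \<and>\<^sub>F f 3 \<and>\<^sub>F f 4 \<and>\<^sub>F f 5 \<and>\<^sub>F f 6"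
  unfolding vol_def symplectic[symmetric]
  by (simp add: expand) (simp add: fun_eq_iff scale_form_def fact_numeral)

lemma volume_nonzero: "vol (omega 0) \<noteq> 0"
proof
  assume z: "vol (omega 0) = 0"
  obtain v1 v2 v3 v4 v5 v6 where
    "f 1 [v1] = 1 \<and> f 2 [v1] = 0 \<and> f 3 [v1] = 0 \<and> f 4 [v1] = 0 \<and> f 5 [v1] = 0 \<and> f 6 [v1] = 0"
    "f 1 [v2] = 0 \<and> f 2 [v2] = 1 \<and> f 3 [v2] = 0 \<and> f 4 [v2] = 0 \<and> f 5 [v2] = 0 \<and> f 6 [v2] = 0"
    "f 1 [v3] = 0 \<and> f 2 [v3] = 0 \<and> f 3 [v3] = 1 \<and> f 4 [v3] = 0 \<and> f 5 [v3] = 0 \<and> f 6 [v3] = 0"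
    "f 1 [v4] = 0 \<and> f 2 [v4] = 0 \<and> f 3 [v4] = 0 \<and> f 4 [v4] = 1 \<and> f 5 [v4] = 0 \<and> f 6 [v4] = 0"
    "f 1 [v5] = 0 \<and> f 2 [v5] = 0 \<and> f 3 [v5] = 0 \<and> f 4 [v5] = 0 \<and> f 5 [v5] = 1 \<and> f 6 [v5] = 0"
    "f 1 [v6] = 0 \<and> f 2 [v6] = 0 \<and> f 3 [v6] = 0 \<and> f 4 [v6] = 0 \<and> f 5 [v6] = 0 \<and> f 6 [v6] = 1"
    using ex_coord by metis
  note v = this
  have "interior v5 (interior v4 (interior v3 (interior v2 (interior v1 (vol (omega 0)))))) [v6] = 1"
    using v unfolding volume by (simp add: expand)
  then show False by (simp add: z interior_linear)
qed

lemma volume_cancel: "c \<cdot> vol (omega 0) = c' \<cdot> vol (omega 0) \<longleftrightarrow> c = c'"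
proof
  assume *: "c \<cdot> vol (omega 0) = c' \<cdot> vol (omega 0)"
  obtain vs where "vol (omega 0) vs \<noteq> 0" using volume_nonzero unfolding fun_eq_iff by auto
  then show "c = c'" using fun_cong[OF *, of vs] by (simp add: scale_form_def)
qed simp

text \<open>
  The wedge product of \<open>f\<^sup>k\<close> with the contraction of the volume form by \<open>u\<close> is the volume form times the
  coordinate \<open>f\<^sup>k(u)\<close>, so the contraction determines all coordinates of \<open>u\<close>.
\<close>

lemma interior_volume_inject:
  assumes "interior u (vol (omega 0)) = interior v (vol (omega 0))"
  shows "u = v"
proof -
  have *: "f k \<and>\<^sub>F interior u (vol (omega 0)) = f k [u] \<cdot> vol (omega 0)" if "k \<in> {1, 2, 3, 4, 5, 6}" for k u
    using that unfolding volume by (auto simp: expand)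
  have "f k [u] = f k [v]" if "k \<in> {1, 2, 3, 4, 5, 6}" for k
    using trans[OF *[OF that, of u, unfolded assms, symmetric] *[OF that, of v]]
    by (simp only: volume_cancel)
  then have "coord u = coord v" by (simp add: vec_eq_iff forall_6 coord_nth)
  then show ?thesis using inj_coord by (simp add: inj_eq)
qed

lemma K_op_eqI:
  assumes "interior u (vol (omega 0)) = - (interior v \<phi> \<and>\<^sub>F \<phi>)"
  shows "K_op (omega 0) \<phi> v = u"
  unfolding K_op_def using assms interior_volume_inject by (intro the_equality) auto

text \<open>
  The vector \<open>K(\<phi>) v\<close> is the one with the listed coordinates: its contraction with the volume form is
  compared with \<open>- \<iota>\<^sub>v \<phi> \<and> \<phi>\<close> monomial by monomial.  Note that \<open>K(\<phi>)\<close> respects the splitting into the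
  4-dimensional part and the plane of \<open>f\<^sup>5, f\<^sup>6\<close>; on the latter its matrix consists of the numbers
  \<open>s, t, m\<close> up to factors \<open>\<plusminus> 2\<close>.
\<close>

lemma K_op_two_plane:
  fixes a d p b c q :: real and v :: "real^6"
  defines "Y \<equiv> K_op (omega 0) (two_plane_form a d p b c q) v"
  shows "f 1 [Y] = - 2 * c * d * f 2 [v] + 2 * c * p * f 3 [v] - 2 * d * q * f 4 [v]"
    and "f 2 [Y] = - 2 * a * b * f 1 [v] + 2 * a * q * f 3 [v] - 2 * b * p * f 4 [v]"
    and "f 3 [Y] = 2 * b * p * f 1 [v] - 2 * d * q * f 2 [v] - 2 * b * d * f 4 [v]"
    and "f 4 [Y] = 2 * a * q * f 1 [v] - 2 * c * p * f 2 [v] - 2 * a * c * f 3 [v]"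
    and "f 5 [Y] = 2 * p * q * f 5 [v] + 2 * (q\<^sup>2 - b * c) * f 6 [v]"
    and "f 6 [Y] = - 2 * (a * d + p\<^sup>2) * f 5 [v] - 2 * p * q * f 6 [v]"
proof -
  obtain u where u: "f 1 [u] = - 2 * c * d * f 2 [v] + 2 * c * p * f 3 [v] - 2 * d * q * f 4 [v]"
    "f 2 [u] = - 2 * a * b * f 1 [v] + 2 * a * q * f 3 [v] - 2 * b * p * f 4 [v]"
    "f 3 [u] = 2 * b * p * f 1 [v] - 2 * d * q * f 2 [v] - 2 * b * d * f 4 [v]"
    "f 4 [u] = 2 * a * q * f 1 [v] - 2 * c * p * f 2 [v] - 2 * a * c * f 3 [v]"
    "f 5 [u] = 2 * p * q * f 5 [v] + 2 * (q\<^sup>2 - b * c) * f 6 [v]"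
    "f 6 [u] = - 2 * (a * d + p\<^sup>2) * f 5 [v] - 2 * p * q * f 6 [v]"
    using ex_coord by metis
  have "interior u (vol (omega 0))
    = - (interior v (two_plane_form a d p b c q) \<and>\<^sub>F two_plane_form a d p b c q)"
    unfolding volume two_plane_form_def
    by (simp add: expand u[unfolded One_nat_def])
       (simp add: fun_eq_iff scale_form_def algebra_simps power2_eq_square)
  then have "Y = u" unfolding Y_def by (rule K_op_eqI)
  then show "f 1 [Y] = - 2 * c * d * f 2 [v] + 2 * c * p * f 3 [v] - 2 * d * q * f 4 [v]"
    "f 2 [Y] = - 2 * a * b * f 1 [v] + 2 * a * q * f 3 [v] - 2 * b * p * f 4 [v]"
    "f 3 [Y] = 2 * b * p * f 1 [v] - 2 * d * q * f 2 [v] - 2 * b * d * f 4 [v]"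
    "f 4 [Y] = 2 * a * q * f 1 [v] - 2 * c * p * f 2 [v] - 2 * a * c * f 3 [v]"
    "f 5 [Y] = 2 * p * q * f 5 [v] + 2 * (q\<^sup>2 - b * c) * f 6 [v]"
    "f 6 [Y] = - 2 * (a * d + p\<^sup>2) * f 5 [v] - 2 * p * q * f 6 [v]"
    using u by simp_all
qed

lemma two_plane_homogeneous:
  "length vs \<noteq> 3 \<Longrightarrow> two_plane_form a d p b c q vs = 0"
  by (simp add: two_plane_form_def scale_form_def monomial3_homogeneous)

text \<open>
  Contraction of \<open>\<phi>\<close> with a vector dual to the plane of \<open>f\<^sup>5, f\<^sup>6\<close> gives a combination of \<open>\<sigma>, \<tau>\<close>, so
  \<open>F(\<phi>)\<close> is again built from these, mixed by the matrix of \<open>K(\<phi>)\<close> on that plane.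
\<close>

lemma F_op_two_plane:
  fixes a d p b c q :: real
  defines "s \<equiv> a * d + p\<^sup>2" and "t \<equiv> b * c - q\<^sup>2" and "m \<equiv> p * q"
  shows "F_op (omega 0) (two_plane_form a d p b c q) =
     (- 4 * m) \<cdot> (a \<cdot> (f 1 \<and>\<^sub>F f 3) + d \<cdot> (f 2 \<and>\<^sub>F f 4) + p \<cdot> (f 1 \<and>\<^sub>F f 2 - f 3 \<and>\<^sub>F f 4)) \<and>\<^sub>F f 5
     + (4 * s) \<cdot> (b \<cdot> (f 1 \<and>\<^sub>F f 4) + c \<cdot> (f 2 \<and>\<^sub>F f 3) + q \<cdot> (f 1 \<and>\<^sub>F f 2 - f 3 \<and>\<^sub>F f 4)) \<and>\<^sub>F f 5
     + (4 * t) \<cdot> (a \<cdot> (f 1 \<and>\<^sub>F f 3) + d \<cdot> (f 2 \<and>\<^sub>F f 4) + p \<cdot> (f 1 \<and>\<^sub>F f 2 - f 3 \<and>\<^sub>F f 4)) \<and>\<^sub>F f 6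
     + (4 * m) \<cdot> (b \<cdot> (f 1 \<and>\<^sub>F f 4) + c \<cdot> (f 2 \<and>\<^sub>F f 3) + q \<cdot> (f 1 \<and>\<^sub>F f 2 - f 3 \<and>\<^sub>F f 4)) \<and>\<^sub>F f 6"
  (is "_ = ?F")
proof (rule form_eqI)
  show "F_op (omega 0) (two_plane_form a d p b c q) [] = ?F []"
    by (simp add: F_op_def wedge_assoc wedge_linear) (simp add: scale_form_def monomial_Nil)
  fix v
  define Y where "Y = K_op (omega 0) (two_plane_form a d p b c q) v"
  note K = K_op_two_plane[of a d p b c q v, folded Y_def]
  have "interior v (F_op (omega 0) (two_plane_form a d p b c q))
      = (- 2) \<cdot> interior Y (two_plane_form a d p b c q)"
    unfolding Y_def by (rule interior_F_op) (rule two_plane_homogeneous)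
  also have "\<dots> = interior v ?F"
    unfolding two_plane_form_def
    by (simp add: expand K[unfolded One_nat_def])
      (simp add: fun_eq_iff scale_form_def algebra_simps power2_eq_square s_def t_def m_def)
  finally show "interior v (F_op (omega 0) (two_plane_form a d p b c q)) = interior v ?F"
.
qed

lemma Q_op_two_plane:
  "Q_op (omega 0) (two_plane_form a d p b c q) = 16 * ((p * q)\<^sup>2 + (a * d + p\<^sup>2) * (b * c - q\<^sup>2))"
proof -
  have *: "two_plane_form a d p b c q \<and>\<^sub>F F_op (omega 0) (two_plane_form a d p b c q)
      = - ((16 * ((p * q)\<^sup>2 + (a * d + p\<^sup>2) * (b * c - q\<^sup>2))) \<cdot> vol (omega 0))"
    unfolding F_op_two_plane volume unfolding two_plane_form_def
    by (simp add: expand) (simp add: fun_eq_iff scale_form_def algebra_simps power2_eq_square)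
  show ?thesis
    unfolding Q_op_def using * volume_cancel by (intro the_equality) auto
qed

end

section \<open>Exterior derivatives of left-invariant forms\<close>

lemma lam_nonzero: "lam \<noteq> 0"
proof -
  have "1 < (3 + sqrt 5) / 2" using real_sqrt_gt_zero[of 5] by (simp add: add_pos_pos)
  then show ?thesis unfolding lam_def by (simp add: ln_gt_zero_iff less_imp_neq[symmetric])
qed

lemma is_form_one_form: "linear g \<Longrightarrow> is_form 1 (one_form g)"
  unfolding is_form_def by (auto simp: one_form_def split: list.split) (auto simp: length_Suc_conv)

lemma is_form_cof: "is_form 1 (cof i x)"
  unfolding cof_def by (rule is_form_one_form) (auto intro!: linearI simp: algebra_simps)

lemma cof_apply: "cof i x [v] = exp (weight i x) * v $ i"
  by (simp add: cof_def one_form_def)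

lemma linear_weight: "linear (weight i)"
  by (rule linearI) (auto simp: weight_def algebra_simps)

lemma cof_scale: "cof i x = exp (weight i x) \<cdot> cof i 0"
  by (auto simp: cof_def one_form_def scale_form_def weight_def fun_eq_iff split: list.split)

text \<open>
  Differentiability of all coefficients is part of the relation because \<open>frechet_derivative\<close> is additive
  only on differentiable functions.
\<close>

definition has_ext_d :: "'v::real_normed_vector dform \<Rightarrow> 'v dform \<Rightarrow> bool" where
  "has_ext_d a b \<longleftrightarrow> (\<forall>x vs. (\<lambda>y. a y vs) differentiable at x) \<and> ext_d a = b"

lemma has_ext_d_cong: "has_ext_d a b \<Longrightarrow> b = b' \<Longrightarrow> has_ext_d a b'"
  by simp

lemma has_ext_d_add:
  assumes "has_ext_d a a'" and "has_ext_d b b'"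
  shows "has_ext_d (\<lambda>x. a x + b x) (\<lambda>x. a' x + b' x)"
proof -
  have a: "(\<lambda>y. a y vs) differentiable at x" and b: "(\<lambda>y. b y vs) differentiable at x" for x vs
    using assms by (auto simp: has_ext_d_def)
  have d: "frechet_derivative (\<lambda>y. a y vs + b y vs) (at x)
      = (\<lambda>h. frechet_derivative (\<lambda>y. a y vs) (at x) h + frechet_derivative (\<lambda>y. b y vs) (at x) h)"
    for x vs
    by (rule frechet_derivative_at[symmetric])
      (rule has_derivative_add[OF a[unfolded frechet_derivative_works] b[unfolded frechet_derivative_works]])
  have "ext_d (\<lambda>x. a x + b x) x vs = ext_d a x vs + ext_d b x vs" for x vs
    by (simp add: ext_d_def d sum.distrib algebra_simps)
  then show ?thesis using assms by (auto simp: has_ext_d_def fun_eq_iff intro!: differentiable_add)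
qed

lemma has_ext_d_scale:
  assumes "has_ext_d a a'"
  shows "has_ext_d (\<lambda>x. c \<cdot> a x) (\<lambda>x. c \<cdot> a' x)"
proof -
  have a: "(\<lambda>y. a y vs) differentiable at x" for x vs
    using assms by (auto simp: has_ext_d_def)
  have d: "frechet_derivative (\<lambda>y. c * a y vs) (at x) = (\<lambda>h. c * frechet_derivative (\<lambda>y. a y vs) (at x) h)"
    for x vs
    by (rule frechet_derivative_at[symmetric])
      (rule has_derivative_mult_right[OF a[unfolded frechet_derivative_works]])
  have "ext_d (\<lambda>x. c \<cdot> a x) x vs = c * ext_d a x vs" for x vs
    by (simp add: ext_d_def scale_form_def d sum_distrib_left algebra_simps)
  then show ?thesis using assms a
    by (auto simp: has_ext_d_def fun_eq_iff scale_form_def intro!: differentiable_mult)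
qed

lemma has_ext_d_diff:
  assumes "has_ext_d a a'" and "has_ext_d b b'"
  shows "has_ext_d (\<lambda>x. a x - b x) (\<lambda>x. a' x - b' x)"
proof -
  have "(\<lambda>x. a x + (- 1) \<cdot> b x) = (\<lambda>x. a x - b x)" for a b :: "'a dform"
    by (simp add: fun_eq_iff scale_form_def)
  then show ?thesis
    using has_ext_d_add[OF assms(1) has_ext_d_scale[OF assms(2), of "- 1"]] by simp
qed

text \<open>
  For a constant-coefficient form \<open>a\<close> the derivative of \<open>exp L \<cdot> a\<close> only sees the exponential, and the
  alternating sum in the definition of the exterior derivative is then the Laplace expansion of a product with the 1-form
  \<open>dL = L\<close>.  Every left-invariant monomial has this shape, since its coefficient is the exponential of a
  sum of weights.
\<close>

lemma has_ext_d_exp: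
  fixes L :: "'v::euclidean_space \<Rightarrow> real"
  assumes "linear L"
  shows "has_ext_d (\<lambda>x. exp (L x) \<cdot> a) (\<lambda>x. one_form L \<and>\<^sub>F exp (L x) \<cdot> a)"
proof -
  have "(L has_derivative L) (at x)" for x
    using assms by (simp add: bounded_linear_imp_has_derivative linear_conv_bounded_linear)
  then have D: "((\<lambda>y. exp (L y) * c) has_derivative (\<lambda>h. exp (L x) * L h * c)) (at x)" for x c
    by (auto intro!: derivative_eq_intros)
  have d: "frechet_derivative (\<lambda>y. exp (L y) * c) (at x) = (\<lambda>h. exp (L x) * L h * c)" for x c
    by (rule frechet_derivative_at[OF D, symmetric])
  have "ext_d (\<lambda>x. exp (L x) \<cdot> a) x vs = (one_form L \<and>\<^sub>F exp (L x) \<cdot> a) vs" for x vs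
    unfolding one_form_wedge_apply[OF is_form_one_form[OF assms]]
    by (simp add: ext_d_def scale_form_def d one_form_def algebra_simps)
  moreover have "(\<lambda>y. (exp (L y) \<cdot> a) vs) differentiable at x" for x vs
    unfolding scale_form_def by (rule differentiableI[OF D])
  ultimately show ?thesis by (auto simp: has_ext_d_def fun_eq_iff)
qed

definition d_weight :: "6 \<Rightarrow> (real^6) form" where
  "d_weight i = one_form (weight i)"

lemma d_weight_eq:
  "d_weight 1 = lam \<cdot> cof 5 x" "d_weight 2 = - (lam \<cdot> cof 5 x)"
  "d_weight 3 = lam \<cdot> cof 6 x" "d_weight 4 = - (lam \<cdot> cof 6 x)"
  by (auto simp: fun_eq_iff d_weight_def cof_def one_form_def scale_form_def weight_def split: list.split)

lemma d_weight_central: "d_weight 5 = 0" "d_weight 6 = 0"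
  by (auto simp: fun_eq_iff d_weight_def one_form_def weight_def split: list.split)

lemma one_form_add: "one_form (\<lambda>v. g v + h v) = one_form g + one_form h"
  by (auto simp: fun_eq_iff one_form_def split: list.split)

lemma has_ext_d_monomial2:
  "has_ext_d (\<lambda>x. cof i x \<and>\<^sub>F cof j x \<and>\<^sub>F g)
     (\<lambda>x. (d_weight i + d_weight j) \<and>\<^sub>F cof i x \<and>\<^sub>F cof j x \<and>\<^sub>F g)"
proof -
  obtain ci cj where c: "\<And>x. cof i x = exp (weight i x) \<cdot> ci" "\<And>x. cof j x = exp (weight j x) \<cdot> cj"
    using cof_scale by meson
  have "linear (\<lambda>x. weight i x + weight j x)"
    by (intro linear_compose_add linear_weight)
  from has_ext_d_exp[OF this, of "ci \<and>\<^sub>F cj \<and>\<^sub>F g"] show ?thesis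
    unfolding one_form_add d_weight_def[symmetric]
    by (simp add: c wedge_linear scale_linear exp_add mult_ac)
qed

lemma has_ext_d_monomial3:
  "has_ext_d (\<lambda>x. cof i x \<and>\<^sub>F cof j x \<and>\<^sub>F cof k x)
     (\<lambda>x. (d_weight i + d_weight j + d_weight k) \<and>\<^sub>F cof i x \<and>\<^sub>F cof j x \<and>\<^sub>F cof k x)"
proof -
  obtain ci cj ck where c: "\<And>x. cof i x = exp (weight i x) \<cdot> ci"
    "\<And>x. cof j x = exp (weight j x) \<cdot> cj" "\<And>x. cof k x = exp (weight k x) \<cdot> ck"
    using cof_scale by meson
  have "linear (\<lambda>x. weight i x + weight j x + weight k x)"
    by (intro linear_compose_add linear_weight)
  from has_ext_d_exp[OF this, of "ci \<and>\<^sub>F cj \<and>\<^sub>F ck"] show ?thesis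
    unfolding one_form_add d_weight_def[symmetric]
    by (simp add: c wedge_linear scale_linear exp_add mult_ac)
qed

definition e :: "real^6 \<Rightarrow> nat \<Rightarrow> (real^6) form" where
  "e x i = cof (of_nat i) x"

lemma cof_e:
  "cof 1 x = e x 1" "cof 2 x = e x 2" "cof 3 x = e x 3"
  "cof 4 x = e x 4" "cof 5 x = e x 5" "cof 6 x = e x 6"
  by (simp_all add: e_def)

interpretation e: one_forms "e x" for x
  by unfold_locales (simp add: e_def is_form_cof[simplified])

lemma e_0_apply: "e 0 i [v] = v $ of_nat i"
  by (simp add: e_def cof_apply weight_def)

lemma omega_eq: "omega x = omega 0"
  by (auto simp: omega_def cof2_eq fun_eq_iff weight_def split: list.split)

text \<open>
  The last two members are chosen so that the sums of weights of \<open>e\<^sup>1\<^sup>3, e\<^sup>2\<^sup>4\<close> are multiples of the fifth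
  and those of \<open>e\<^sup>1\<^sup>4, e\<^sup>2\<^sup>3\<close> multiples of the sixth; the factor \<open>1/2\<close> keeps the coframe symplectic.
\<close>

definition frame :: "real^6 \<Rightarrow> nat \<Rightarrow> (real^6) form" where
  "frame x i = (if i = 5 then cof 5 x + cof 6 x else if i = 6 then (1/2) \<cdot> (cof 6 x - cof 5 x)
     else cof (of_nat i) x)"

lemma frame_e:
  "frame x 1 = e x 1" "frame x 2 = e x 2" "frame x 3 = e x 3" "frame x 4 = e x 4"
  "frame x 5 = e x 5 + e x 6" "frame x 6 = (1/2) \<cdot> (e x 6 - e x 5)"
  by (simp_all add: frame_def e_def)

interpretation frame: symplectic_coframe "frame x" for x
proof unfold_locales
  show "is_form 1 (frame x i)" for i
    by (simp add: frame_def is_form_1_linear[simplified] is_form_cof[simplified])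
  have "omega x = e x 1 \<and>\<^sub>F e x 2 + e x 3 \<and>\<^sub>F e x 4 + e x 5 \<and>\<^sub>F e x 6"
    by (simp add: omega_def cof2_def cof_e[simplified])
  then show "frame x 1 \<and>\<^sub>F frame x 2 + frame x 3 \<and>\<^sub>F frame x 4 + frame x 5 \<and>\<^sub>F frame x 6 = omega 0"
    unfolding frame_e omega_eq[symmetric, of x] by (simp add: e.expand)
qed

lemma matrix_inv_eqI:
  fixes X Y :: "real^'n^'n"
  assumes "X ** Y = mat 1" "Y ** X = mat 1"
  shows "matrix_inv X = Y"
proof -
  have "X ** matrix_inv X = mat 1 \<and> matrix_inv X ** X = mat 1"
    unfolding matrix_inv_def by (rule someI[of _ Y]) (use assms in simp)
  then have "Y ** (X ** matrix_inv X) = Y" by simp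
  then show ?thesis by (simp add: matrix_mul_assoc assms)
qed

text \<open>
  The matrix of \<open>\<omega>\<close> squares to \<open>- 1\<close>, so its inverse is its negative.
\<close>

lemma Lefschetz_omega:
  "Lefschetz (omega x) a = (1 / 2) \<cdot>
     (interior (axis 2 1) (interior (axis 1 1) a) - interior (axis 1 1) (interior (axis 2 1) a)
    + (interior (axis 4 1) (interior (axis 3 1) a) - interior (axis 3 1) (interior (axis 4 1) a))
    + (interior (axis 6 1) (interior (axis 5 1) a) - interior (axis 5 1) (interior (axis 6 1) a)))"
proof -
  define X :: "real^6^6" where "X = (\<chi> k l. omega 0 [axis k 1, axis l 1])"
  have X: "X $ i $ j = (if (i, j) \<in> {(1, 2), (3, 4), (5, 6)} then 1
      else if (i, j) \<in> {(2, 1), (4, 3), (6, 5)} then - 1 else 0)" for i j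
    unfolding X_def using exhaust_6[of i] exhaust_6[of j]
    by (elim disjE) (simp_all add: omega_0_apply axis_def)
  have inv: "matrix_inv X = - X"
    by (rule matrix_inv_eqI) (simp_all add: vec_eq_iff forall_6 matrix_matrix_mult_def sum_6 X mat_def)
  show ?thesis
    unfolding Lefschetz_def omega_eq[of x] X_def[symmetric] inv
    by (simp add: sum_6 X interior_def scale_form_def fun_eq_iff)
qed

text \<open>
  The general left-invariant primitive 3-form, with its fourteen coefficients.
\<close>

definition general_form where
  "general_form A B C D E F G H I J K L M N x =
      A \<cdot> cof3 1 3 5 x + B \<cdot> cof3 1 3 6 x + C \<cdot> cof3 1 4 5 x + D \<cdot> cof3 1 4 6 x
      + E \<cdot> cof3 2 3 5 x + F \<cdot> cof3 2 3 6 x + G \<cdot> cof3 2 4 5 x + H \<cdot> cof3 2 4 6 x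
      + (I \<cdot> cof 1 x + J \<cdot> cof 2 x) \<and>\<^sub>F (cof2 3 4 x - cof2 5 6 x)
      + (K \<cdot> cof 3 x + L \<cdot> cof 4 x) \<and>\<^sub>F (cof2 1 2 x - cof2 5 6 x)
      + (M \<cdot> cof 5 x + N \<cdot> cof 6 x) \<and>\<^sub>F (cof2 1 2 x - cof2 3 4 x)"

text \<open>
  Each monomial \<open>e\<^sup>i\<^sup>j\<^sup>k\<close> is multiplied by the sum of its three weights.  The terms with \<open>M, N\<close> and the
  products with \<open>e\<^sup>5\<^sup>6\<close> contribute nothing.
\<close>

lemma has_ext_d_general_form:
  "has_ext_d (general_form A B C D E F G H I J K L M N) (\<lambda>x. lam \<cdot>
     ((B - A) \<cdot> e x 1 \<and>\<^sub>F e x 3 \<and>\<^sub>F e x 5 \<and>\<^sub>F e x 6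
    + (C + D) \<cdot> e x 1 \<and>\<^sub>F e x 4 \<and>\<^sub>F e x 5 \<and>\<^sub>F e x 6
    - (E + F) \<cdot> e x 2 \<and>\<^sub>F e x 3 \<and>\<^sub>F e x 5 \<and>\<^sub>F e x 6
    + (G - H) \<cdot> e x 2 \<and>\<^sub>F e x 4 \<and>\<^sub>F e x 5 \<and>\<^sub>F e x 6
    - I \<cdot> e x 1 \<and>\<^sub>F e x 3 \<and>\<^sub>F e x 4 \<and>\<^sub>F e x 5
    + J \<cdot> e x 2 \<and>\<^sub>F e x 3 \<and>\<^sub>F e x 4 \<and>\<^sub>F e x 5
    - K \<cdot> e x 1 \<and>\<^sub>F e x 2 \<and>\<^sub>F e x 3 \<and>\<^sub>F e x 6
    + L \<cdot> e x 1 \<and>\<^sub>F e x 2 \<and>\<^sub>F e x 4 \<and>\<^sub>F e x 6))"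
proof -
  have expanded: "general_form A B C D E F G H I J K L M N = (\<lambda>x.
      A \<cdot> cof3 1 3 5 x + B \<cdot> cof3 1 3 6 x + C \<cdot> cof3 1 4 5 x + D \<cdot> cof3 1 4 6 x
      + E \<cdot> cof3 2 3 5 x + F \<cdot> cof3 2 3 6 x + G \<cdot> cof3 2 4 5 x + H \<cdot> cof3 2 4 6 x
      + I \<cdot> (cof3 1 3 4 x - cof3 1 5 6 x) + J \<cdot> (cof3 2 3 4 x - cof3 2 5 6 x)
      + K \<cdot> (cof3 3 1 2 x - cof3 3 5 6 x) + L \<cdot> (cof3 4 1 2 x - cof3 4 5 6 x)
      + M \<cdot> (cof3 5 1 2 x - cof3 5 3 4 x) + N \<cdot> (cof3 6 1 2 x - cof3 6 3 4 x))"
    by (simp add: fun_eq_iff general_form_def cof3_def cof2_def wedge_linear)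
      (simp add: scale_form_def wedge_linear algebra_simps)
  show ?thesis
    unfolding expanded cof3_def
    apply (rule has_ext_d_cong)
     apply (rule has_ext_d_add has_ext_d_diff has_ext_d_scale has_ext_d_monomial3)+
    apply (rule ext)
    subgoal for x
      by (simp add: d_weight_eq[of x, simplified] d_weight_central cof_e[simplified] e.expand)
        (simp add: fun_eq_iff scale_form_def algebra_simps)
    done
qed

section \<open>Closed forms and stationary points\<close>

text \<open>
  The eight monomials in the differential are independent: evaluated at the neutral element on four basis
  vectors, the differential returns a single coefficient.
\<close>

lemma integrable_general_form:
  "integrable_form (general_form A B C D E F G H I J K L M N) \<longleftrightarrow>
    B = A \<and> D = - C \<and> F = - E \<and> G = H \<and> I = 0 \<and> J = 0 \<and> K = 0 \<and> L = 0" (is "?i \<longleftrightarrow> ?c")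
proof
  let ?d = "ext_d (general_form A B C D E F G H I J K L M N)"
  let ?ev = "\<lambda>h i j k a. interior (axis j 1) (interior (axis i 1) (interior (axis h 1) a)) [axis k (1::real)]"
  note d = has_ext_d_general_form[of A B C D E F G H I J K L M N, unfolded has_ext_d_def, THEN conjunct2]
  {
    assume ?i
    then have z: "?d 0 = 0" by (simp add: integrable_form_def)
    have "?ev 1 3 5 6 (?d 0) = lam * (B - A)" "?ev 1 4 5 6 (?d 0) = lam * (C + D)"
      "?ev 2 3 5 6 (?d 0) = - (lam * (E + F))" "?ev 2 4 5 6 (?d 0) = lam * (G - H)"
      "?ev 1 3 4 5 (?d 0) = - (lam * I)" "?ev 2 3 4 5 (?d 0) = lam * J"
      "?ev 1 2 3 6 (?d 0) = - (lam * K)" "?ev 1 2 4 6 (?d 0) = lam * L"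
      unfolding d
      by (simp_all add: e.expand e_0_apply axis_def)
        (simp_all add: e_0_apply axis_def scale_form_def)
    then show ?c using lam_nonzero unfolding z interior_linear by auto
  next
    assume ?c
    then show ?i unfolding integrable_form_def d
      by (intro ext) (simp add: scale_linear wedge_linear)
  }
qed

text \<open>
  The last two coefficients come from \<open>M e\<^sup>5 + N e\<^sup>6 = (M + N)/2 f\<^sup>5 + (N - M) f\<^sup>6\<close>, the factors
  \<open>- 2\<close> from \<open>e\<^sup>5 - e\<^sup>6 = - 2 f\<^sup>6\<close>.
\<close>

lemma closed_general_form:
  "general_form \<alpha> \<alpha> \<beta> (- \<beta>) \<gamma> (- \<gamma>) (- \<delta>) (- \<delta>) 0 0 0 0 M N x
   = frame.two_plane_form x \<alpha> (- \<delta>) ((M + N) / 2) (- 2 * \<beta>) (- 2 * \<gamma>) (N - M)"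
  unfolding general_form_def frame.two_plane_form_def frame_e cof3_def cof2_def cof_e
  by (simp add: e.expand) (simp add: fun_eq_iff scale_form_def algebra_simps add_divide_distrib diff_divide_distrib)

lemma frame_cof:
  "frame x 1 = cof 1 x" "frame x 2 = cof 2 x" "frame x 3 = cof 3 x" "frame x 4 = cof 4 x"
  "frame x 5 = cof 5 x + cof 6 x" "frame x 6 = (1/2) \<cdot> (cof 6 x - cof 5 x)"
  by (simp_all add: frame_def)

text \<open>
  As constant forms, the last two members can be treated as fixed factors under differentiation.
\<close>

lemma frame_constant: "frame x 5 = frame 0 5" "frame x 6 = frame 0 6"
  by (simp_all add: frame_def cof_def weight_def)

lemma has_ext_d_frame:
  "has_ext_d (\<lambda>x. frame x 1 \<and>\<^sub>F frame x 3 \<and>\<^sub>F g)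
     (\<lambda>x. lam \<cdot> (frame x 5 \<and>\<^sub>F frame x 1 \<and>\<^sub>F frame x 3 \<and>\<^sub>F g))"
  "has_ext_d (\<lambda>x. frame x 2 \<and>\<^sub>F frame x 4 \<and>\<^sub>F g)
     (\<lambda>x. (- lam) \<cdot> (frame x 5 \<and>\<^sub>F frame x 2 \<and>\<^sub>F frame x 4 \<and>\<^sub>F g))"
  "has_ext_d (\<lambda>x. frame x 1 \<and>\<^sub>F frame x 4 \<and>\<^sub>F g)
     (\<lambda>x. (- 2 * lam) \<cdot> (frame x 6 \<and>\<^sub>F frame x 1 \<and>\<^sub>F frame x 4 \<and>\<^sub>F g))"
  "has_ext_d (\<lambda>x. frame x 2 \<and>\<^sub>F frame x 3 \<and>\<^sub>F g)
     (\<lambda>x. (2 * lam) \<cdot> (frame x 6 \<and>\<^sub>F frame x 2 \<and>\<^sub>F frame x 3 \<and>\<^sub>F g))"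
  "has_ext_d (\<lambda>x. frame x 1 \<and>\<^sub>F frame x 2 \<and>\<^sub>F g) (\<lambda>x. 0)"
  "has_ext_d (\<lambda>x. frame x 3 \<and>\<^sub>F frame x 4 \<and>\<^sub>F g) (\<lambda>x. 0)"
proof -
  have w: "d_weight 1 + d_weight 3 = lam \<cdot> frame x 5" "d_weight 2 + d_weight 4 = (- lam) \<cdot> frame x 5"
    "d_weight 1 + d_weight 4 = (- 2 * lam) \<cdot> frame x 6" "d_weight 2 + d_weight 3 = (2 * lam) \<cdot> frame x 6"
    "d_weight 1 + d_weight 2 = 0" "d_weight 3 + d_weight 4 = 0" for x
    unfolding d_weight_eq[of x] frame_cof by (simp_all add: fun_eq_iff scale_form_def algebra_simps)
  have *: "has_ext_d (\<lambda>x. cof i x \<and>\<^sub>F cof j x \<and>\<^sub>F g) (\<lambda>x. r \<cdot> (frame x k \<and>\<^sub>F cof i x \<and>\<^sub>F cof j x \<and>\<^sub>F g))"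
    if "\<And>x. d_weight i + d_weight j = r \<cdot> frame x k" for i j k r
    using has_ext_d_monomial2[of i j g]
    by (rule has_ext_d_cong) (rule ext, subst that, rule wedge_linear(4))
  show "has_ext_d (\<lambda>x. frame x 1 \<and>\<^sub>F frame x 3 \<and>\<^sub>F g)
     (\<lambda>x. lam \<cdot> (frame x 5 \<and>\<^sub>F frame x 1 \<and>\<^sub>F frame x 3 \<and>\<^sub>F g))"
    unfolding frame_cof(1-4) by (intro * w)
  show "has_ext_d (\<lambda>x. frame x 2 \<and>\<^sub>F frame x 4 \<and>\<^sub>F g)
     (\<lambda>x. (- lam) \<cdot> (frame x 5 \<and>\<^sub>F frame x 2 \<and>\<^sub>F frame x 4 \<and>\<^sub>F g))"
    unfolding frame_cof(1-4) by (intro * w)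
  show "has_ext_d (\<lambda>x. frame x 1 \<and>\<^sub>F frame x 4 \<and>\<^sub>F g)
     (\<lambda>x. (- 2 * lam) \<cdot> (frame x 6 \<and>\<^sub>F frame x 1 \<and>\<^sub>F frame x 4 \<and>\<^sub>F g))"
    unfolding frame_cof(1-4) by (intro * w)
  show "has_ext_d (\<lambda>x. frame x 2 \<and>\<^sub>F frame x 3 \<and>\<^sub>F g)
     (\<lambda>x. (2 * lam) \<cdot> (frame x 6 \<and>\<^sub>F frame x 2 \<and>\<^sub>F frame x 3 \<and>\<^sub>F g))"
    unfolding frame_cof(1-4) by (intro * w)
  show "has_ext_d (\<lambda>x. frame x 1 \<and>\<^sub>F frame x 2 \<and>\<^sub>F g) (\<lambda>x. 0)"
    "has_ext_d (\<lambda>x. frame x 3 \<and>\<^sub>F frame x 4 \<and>\<^sub>F g) (\<lambda>x. 0)"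
    using has_ext_d_monomial2[of 1 2 g] has_ext_d_monomial2[of 3 4 g]
    by (simp_all only: w frame_cof(1-4) wedge_linear)
qed

lemma frame_apply_axis:
  "frame x 1 [axis i 1] = (if i = 1 then exp (weight 1 x) else 0)"
  "frame x 2 [axis i 1] = (if i = 2 then exp (weight 2 x) else 0)"
  "frame x 3 [axis i 1] = (if i = 3 then exp (weight 3 x) else 0)"
  "frame x 4 [axis i 1] = (if i = 4 then exp (weight 4 x) else 0)"
  "frame x 5 [axis i 1] = (if i = 5 \<or> i = 6 then 1 else 0)"
  "frame x 6 [axis i 1] = (if i = 5 then - 1 / 2 else if i = 6 then 1 / 2 else 0)"
  by (auto simp: frame_def cof_apply axis_def weight_def scale_form_def)

text \<open>
  In this context the form is closed, with \<open>\<sigma>\<^sup>2 = - 2 s f\<^sup>1\<^sup>2\<^sup>3\<^sup>4\<close> and \<open>\<tau>\<^sup>2 = 2 t f\<^sup>1\<^sup>2\<^sup>3\<^sup>4\<close>.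
\<close>

context
  fixes a d p b c q s t :: real and \<phi> :: "(real^6) dform"
  assumes phi: "\<And>x. \<phi> x = frame.two_plane_form x a d p b c q"
    and s: "s = a * d + p\<^sup>2" and t: "t = b * c - q\<^sup>2"
begin

text \<open>
  The differential of \<open>e\<^sup>1\<^sup>3, e\<^sup>2\<^sup>4\<close> carries a factor \<open>f\<^sup>5\<close> and that of \<open>e\<^sup>1\<^sup>4, e\<^sup>2\<^sup>3\<close> a factor \<open>f\<^sup>6\<close>,
  so only \<open>s \<tau> f\<^sup>5\<close> and \<open>t \<sigma> f\<^sup>6\<close> can fail to be closed.
\<close>

lemma has_ext_d_F_form:
  "has_ext_d (F_form \<phi>) (\<lambda>x. lam \<cdot> (
     (8 * s) \<cdot> (b \<cdot> (frame x 1 \<and>\<^sub>F frame x 4 \<and>\<^sub>F frame x 5 \<and>\<^sub>F frame x 6)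
       - c \<cdot> (frame x 2 \<and>\<^sub>F frame x 3 \<and>\<^sub>F frame x 5 \<and>\<^sub>F frame x 6))
   + (4 * t) \<cdot> (a \<cdot> (frame x 1 \<and>\<^sub>F frame x 3 \<and>\<^sub>F frame x 5 \<and>\<^sub>F frame x 6)
       - d \<cdot> (frame x 2 \<and>\<^sub>F frame x 4 \<and>\<^sub>F frame x 5 \<and>\<^sub>F frame x 6))))"
  (is "has_ext_d _ ?d")
proof -
  let ?m = "p * q"
  let ?F = "\<lambda>g h x.
     (- 4 * ?m) \<cdot> (a \<cdot> (frame x 1 \<and>\<^sub>F frame x 3 \<and>\<^sub>F g) + d \<cdot> (frame x 2 \<and>\<^sub>F frame x 4 \<and>\<^sub>F g)
        + p \<cdot> (frame x 1 \<and>\<^sub>F frame x 2 \<and>\<^sub>F g - frame x 3 \<and>\<^sub>F frame x 4 \<and>\<^sub>F g))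
     + (4 * s) \<cdot> (b \<cdot> (frame x 1 \<and>\<^sub>F frame x 4 \<and>\<^sub>F g) + c \<cdot> (frame x 2 \<and>\<^sub>F frame x 3 \<and>\<^sub>F g)
        + q \<cdot> (frame x 1 \<and>\<^sub>F frame x 2 \<and>\<^sub>F g - frame x 3 \<and>\<^sub>F frame x 4 \<and>\<^sub>F g))
     + (4 * t) \<cdot> (a \<cdot> (frame x 1 \<and>\<^sub>F frame x 3 \<and>\<^sub>F h) + d \<cdot> (frame x 2 \<and>\<^sub>F frame x 4 \<and>\<^sub>F h)
        + p \<cdot> (frame x 1 \<and>\<^sub>F frame x 2 \<and>\<^sub>F h - frame x 3 \<and>\<^sub>F frame x 4 \<and>\<^sub>F h))
     + (4 * ?m) \<cdot> (b \<cdot> (frame x 1 \<and>\<^sub>F frame x 4 \<and>\<^sub>F h) + c \<cdot> (frame x 2 \<and>\<^sub>F frame x 3 \<and>\<^sub>F h)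
        + q \<cdot> (frame x 1 \<and>\<^sub>F frame x 2 \<and>\<^sub>F h - frame x 3 \<and>\<^sub>F frame x 4 \<and>\<^sub>F h))"
  have F: "F_form \<phi> = ?F (frame 0 5) (frame 0 6)"
  proof
    fix x
    show "F_form \<phi> x = ?F (frame 0 5) (frame 0 6) x"
      unfolding F_form_def phi omega_eq[of x] frame.F_op_two_plane s t frame_constant[of x, symmetric]
      by (simp add: wedge_linear wedge_assoc)
  qed
  have "has_ext_d (?F g h) (\<lambda>x.
     (- 4 * ?m) \<cdot> (a \<cdot> lam \<cdot> (frame x 5 \<and>\<^sub>F frame x 1 \<and>\<^sub>F frame x 3 \<and>\<^sub>F g)
        + d \<cdot> (- lam) \<cdot> (frame x 5 \<and>\<^sub>F frame x 2 \<and>\<^sub>F frame x 4 \<and>\<^sub>F g) + p \<cdot> (0 - 0))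
     + (4 * s) \<cdot> (b \<cdot> (- 2 * lam) \<cdot> (frame x 6 \<and>\<^sub>F frame x 1 \<and>\<^sub>F frame x 4 \<and>\<^sub>F g)
        + c \<cdot> (2 * lam) \<cdot> (frame x 6 \<and>\<^sub>F frame x 2 \<and>\<^sub>F frame x 3 \<and>\<^sub>F g) + q \<cdot> (0 - 0))
     + (4 * t) \<cdot> (a \<cdot> lam \<cdot> (frame x 5 \<and>\<^sub>F frame x 1 \<and>\<^sub>F frame x 3 \<and>\<^sub>F h)
        + d \<cdot> (- lam) \<cdot> (frame x 5 \<and>\<^sub>F frame x 2 \<and>\<^sub>F frame x 4 \<and>\<^sub>F h) + p \<cdot> (0 - 0))
     + (4 * ?m) \<cdot> (b \<cdot> (- 2 * lam) \<cdot> (frame x 6 \<and>\<^sub>F frame x 1 \<and>\<^sub>F frame x 4 \<and>\<^sub>F h)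
        + c \<cdot> (2 * lam) \<cdot> (frame x 6 \<and>\<^sub>F frame x 2 \<and>\<^sub>F frame x 3 \<and>\<^sub>F h) + q \<cdot> (0 - 0)))" for g h
    by (rule has_ext_d_add has_ext_d_diff has_ext_d_scale has_ext_d_frame)+
  from this[of "frame 0 5" "frame 0 6"] show ?thesis
    unfolding F
    apply (rule has_ext_d_cong)
    apply (rule ext)
    subgoal for x
      unfolding frame_constant[of x, symmetric]
      by (simp add: frame.expand) (simp add: fun_eq_iff scale_form_def algebra_simps)
    done
qed

text \<open>
  None of \<open>f\<^sup>1\<^sup>3, f\<^sup>2\<^sup>4, f\<^sup>1\<^sup>4, f\<^sup>2\<^sup>3\<close> meets the bivector dual to \<open>\<omega>\<close>, so the contraction only takes away
  \<open>f\<^sup>5\<^sup>6\<close>.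
\<close>

lemma Lam_ext_d_F_form:
  "Lam (ext_d (F_form \<phi>)) x = lam \<cdot> (
     (8 * s) \<cdot> (b \<cdot> (frame x 1 \<and>\<^sub>F frame x 4) - c \<cdot> (frame x 2 \<and>\<^sub>F frame x 3))
   + (4 * t) \<cdot> (a \<cdot> (frame x 1 \<and>\<^sub>F frame x 3) - d \<cdot> (frame x 2 \<and>\<^sub>F frame x 4)))"
  unfolding Lam_def has_ext_d_F_form[unfolded has_ext_d_def, THEN conjunct2] Lefschetz_omega
  by (simp add: frame.expand frame_apply_axis[simplified])
    (simp add: fun_eq_iff scale_form_def algebra_simps)

lemma has_ext_d_Lam:
  "has_ext_d (Lam (ext_d (F_form \<phi>))) (\<lambda>x. (4 * lam\<^sup>2) \<cdot> (
     (- 4 * s) \<cdot> (b \<cdot> (frame x 1 \<and>\<^sub>F frame x 4 \<and>\<^sub>F frame x 6) + c \<cdot> (frame x 2 \<and>\<^sub>F frame x 3 \<and>\<^sub>F frame x 6))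
   + t \<cdot> (a \<cdot> (frame x 1 \<and>\<^sub>F frame x 3 \<and>\<^sub>F frame x 5) + d \<cdot> (frame x 2 \<and>\<^sub>F frame x 4 \<and>\<^sub>F frame x 5))))"
proof -
  note d = has_ext_d_frame[where g = unit_form, unfolded wedge_unit]
  have "has_ext_d (\<lambda>x. lam \<cdot> (
     (8 * s) \<cdot> (b \<cdot> (frame x 1 \<and>\<^sub>F frame x 4) - c \<cdot> (frame x 2 \<and>\<^sub>F frame x 3))
   + (4 * t) \<cdot> (a \<cdot> (frame x 1 \<and>\<^sub>F frame x 3) - d \<cdot> (frame x 2 \<and>\<^sub>F frame x 4))))
   (\<lambda>x. lam \<cdot> ((8 * s) \<cdot> (b \<cdot> (- 2 * lam) \<cdot> (frame x 6 \<and>\<^sub>F frame x 1 \<and>\<^sub>F frame x 4)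
        - c \<cdot> (2 * lam) \<cdot> (frame x 6 \<and>\<^sub>F frame x 2 \<and>\<^sub>F frame x 3))
     + (4 * t) \<cdot> (a \<cdot> lam \<cdot> (frame x 5 \<and>\<^sub>F frame x 1 \<and>\<^sub>F frame x 3)
        - d \<cdot> (- lam) \<cdot> (frame x 5 \<and>\<^sub>F frame x 2 \<and>\<^sub>F frame x 4))))"
    by (rule has_ext_d_add has_ext_d_diff has_ext_d_scale d)+
  then show ?thesis
    unfolding Lam_ext_d_F_form[abs_def]
    by (rule has_ext_d_cong, intro ext)
      (simp add: frame.expand, simp add: fun_eq_iff scale_form_def algebra_simps power2_eq_square)
qed

lemma F_integrable_iff: "F_integrable \<phi> \<longleftrightarrow> s * b = 0 \<and> s * c = 0 \<and> t * a = 0 \<and> t * d = 0"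
proof
  note d = has_ext_d_F_form[unfolded has_ext_d_def, THEN conjunct2]
  let ?ev = "\<lambda>i j a. interior (axis 5 1) (interior (axis j 1) (interior (axis i 1) a)) [axis 6 (1::real)]"
  {
    assume "F_integrable \<phi>"
    then have z: "ext_d (F_form \<phi>) 0 = 0" by (simp add: F_integrable_def)
    have "?ev 1 4 (ext_d (F_form \<phi>) 0) = 8 * lam * (s * b)"
      "?ev 2 3 (ext_d (F_form \<phi>) 0) = - 8 * lam * (s * c)"
      "?ev 1 3 (ext_d (F_form \<phi>) 0) = 4 * lam * (t * a)"
      "?ev 2 4 (ext_d (F_form \<phi>) 0) = - 4 * lam * (t * d)"
      unfolding d
      by (simp_all add: frame.expand frame_apply_axis[simplified])
        (simp_all add: frame_apply_axis[simplified] scale_form_def weight_def)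
    then show "s * b = 0 \<and> s * c = 0 \<and> t * a = 0 \<and> t * d = 0"
      using lam_nonzero by (simp add: z interior_linear)
  next
    assume "s * b = 0 \<and> s * c = 0 \<and> t * a = 0 \<and> t * d = 0"
    then show "F_integrable \<phi>"
      unfolding F_integrable_def d by (intro ext) (auto simp: scale_linear)
  }
qed

lemma stationary_iff: "stationary \<phi> \<longleftrightarrow> s * b = 0 \<and> s * c = 0 \<and> t * a = 0 \<and> t * d = 0"
proof
  note d = has_ext_d_Lam[unfolded has_ext_d_def, THEN conjunct2]
  let ?ev = "\<lambda>i j a. interior (axis j 1) (interior (axis i 1) a) [axis 5 (1::real)]"
  let ?S = "ext_d (Lam (ext_d (F_form \<phi>)))"
  {
    assume "stationary \<phi>"
    then have z: "?S 0 = 0" by (simp add: stationary_def)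
    have "?ev 1 4 (?S 0) = 8 * lam\<^sup>2 * (s * b)"
      "?ev 2 3 (?S 0) = 8 * lam\<^sup>2 * (s * c)"
      "?ev 1 3 (?S 0) = 4 * lam\<^sup>2 * (t * a)"
      "?ev 2 4 (?S 0) = 4 * lam\<^sup>2 * (t * d)"
      unfolding d
      by (simp_all add: frame.expand frame_apply_axis[simplified])
        (simp_all add: frame_apply_axis[simplified] scale_form_def weight_def)
    then show "s * b = 0 \<and> s * c = 0 \<and> t * a = 0 \<and> t * d = 0"
      using lam_nonzero by (simp add: z interior_linear)
  next
    assume "s * b = 0 \<and> s * c = 0 \<and> t * a = 0 \<and> t * d = 0"
    then show "stationary \<phi>"
      unfolding stationary_def d by (intro ext) (auto simp: scale_linear)
  }
qed

lemma Q_fun_eq: "Q_fun \<phi> x = 16 * ((p * q)\<^sup>2 + s * t)"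
  unfolding Q_fun_def phi omega_eq[of x] frame.Q_op_two_plane s t ..

end

section \<open>Symplectic orbits\<close>

lemma pullback_wedge: "pullback g (a \<and>\<^sub>F b) = pullback g a \<and>\<^sub>F pullback g b"
  by (simp add: fun_eq_iff pullback_def wedge_def nths_map)

lemma pullback_linear:
  "pullback g (a + b) = pullback g a + pullback g b"
  "pullback g (a - b) = pullback g a - pullback g b"
  "pullback g (c \<cdot> a) = c \<cdot> pullback g a"
  by (auto simp: pullback_def scale_form_def)

definition normal_orbits :: "(real^6) form set" where
  "normal_orbits = (\<Union>\<mu>\<in>{0<..}. O_plus \<mu>) \<union> O1_plus \<union> O1_minus \<union> O3_prim \<union> O6"

definition sextuple :: "'a \<Rightarrow> 'a \<Rightarrow> 'a \<Rightarrow> 'a \<Rightarrow> 'a \<Rightarrow> 'a \<Rightarrow> nat \<Rightarrow> 'a" where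
  "sextuple x1 x2 x3 x4 x5 x6 i = (if i = 1 then x1 else if i = 2 then x2 else if i = 3 then x3
     else if i = 4 then x4 else if i = 5 then x5 else x6)"

lemma sextuple_simps [simp]:
  "sextuple x1 x2 x3 x4 x5 x6 (Suc 0) = x1" "sextuple x1 x2 x3 x4 x5 x6 2 = x2" "sextuple x1 x2 x3 x4 x5 x6 3 = x3"
  "sextuple x1 x2 x3 x4 x5 x6 4 = x4" "sextuple x1 x2 x3 x4 x5 x6 5 = x5" "sextuple x1 x2 x3 x4 x5 x6 6 = x6"
  by (simp_all add: sextuple_def)

context symplectic_coframe
begin

lemma pullback_cof: "pullback coord (cof k 0) = f (coord_index k)"
proof
  fix vs
  show "pullback coord (cof k 0) vs = f (coord_index k) vs"
  proof (cases "length vs = 1")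
    case True
    then obtain v where "vs = [v]" by (auto simp: length_Suc_conv)
    then show ?thesis by (simp add: pullback_def cof_apply weight_def coord_def)
  next
    case False
    then show ?thesis
      using one[of "coord_index k"] is_form_cof[of k 0] by (simp add: pullback_def is_form_def)
  qed
qed

lemmas pullback_monomials = pullback_linear pullback_wedge cof2_def cof3_def pullback_cof coord_index_def

lemma coord_Sp: "coord \<in> Sp (omega 0)"
proof -
  have "pullback coord (omega 0) = omega 0"
    by (subst symplectic[symmetric]) (simp add: omega_def pullback_monomials)
  then show ?thesis by (simp add: Sp_def linear_coord bij_coord)
qed

text \<open>
  Writing a form in normal form in some symplectic coframe puts it into the corresponding orbit, because
  \<open>coord\<close> pulls the standard coframe back to the given one.
\<close>

lemma normal_forms:
  "\<mu> > 0 \<Longrightarrow> \<mu> \<cdot> (f 1 \<and>\<^sub>F f 3 \<and>\<^sub>F f 5 + f 2 \<and>\<^sub>F f 4 \<and>\<^sub>F f 6) \<in> normal_orbits"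
  "(f 1 \<and>\<^sub>F f 3 - f 2 \<and>\<^sub>F f 4) \<and>\<^sub>F f 5 \<in> normal_orbits"
  "(f 1 \<and>\<^sub>F f 3 + f 2 \<and>\<^sub>F f 4) \<and>\<^sub>F f 5 \<in> normal_orbits"
  "f 1 \<and>\<^sub>F f 3 \<and>\<^sub>F f 5 \<in> normal_orbits"
proof -
  have "pullback coord p \<in> Sp_orbit (omega 0) p" for p
    unfolding Sp_orbit_def using coord_Sp by blast
  from this[of "\<mu> \<cdot> (cof3 1 3 5 0 + cof3 2 4 6 0)"] this[of "(cof2 1 3 0 - cof2 2 4 0) \<and>\<^sub>F cof 5 0"]
    this[of "(cof2 1 3 0 + cof2 2 4 0) \<and>\<^sub>F cof 5 0"] this[of "cof3 1 3 5 0"]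
  have "\<mu> \<cdot> (f 1 \<and>\<^sub>F f 3 \<and>\<^sub>F f 5 + f 2 \<and>\<^sub>F f 4 \<and>\<^sub>F f 6) \<in> O_plus \<mu>"
    "(f 1 \<and>\<^sub>F f 3 - f 2 \<and>\<^sub>F f 4) \<and>\<^sub>F f 5 \<in> O1_plus"
    "(f 1 \<and>\<^sub>F f 3 + f 2 \<and>\<^sub>F f 4) \<and>\<^sub>F f 5 \<in> O1_minus"
    "f 1 \<and>\<^sub>F f 3 \<and>\<^sub>F f 5 \<in> O3_prim"
    unfolding O_plus_def O1_plus_def O1_minus_def O3_prim_def
    by (simp_all add: pullback_monomials)
  then show "\<mu> > 0 \<Longrightarrow> \<mu> \<cdot> (f 1 \<and>\<^sub>F f 3 \<and>\<^sub>F f 5 + f 2 \<and>\<^sub>F f 4 \<and>\<^sub>F f 6) \<in> normal_orbits"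
    "(f 1 \<and>\<^sub>F f 3 - f 2 \<and>\<^sub>F f 4) \<and>\<^sub>F f 5 \<in> normal_orbits"
    "(f 1 \<and>\<^sub>F f 3 + f 2 \<and>\<^sub>F f 4) \<and>\<^sub>F f 5 \<in> normal_orbits"
    "f 1 \<and>\<^sub>F f 3 \<and>\<^sub>F f 5 \<in> normal_orbits"
    by (auto simp: normal_orbits_def)
qed

lemma zero_normal: "0 \<in> normal_orbits"
  by (simp add: normal_orbits_def O6_def)

text \<open>
  All changes of coframe below are obtained from this rule, whose last premise is an identity between
  combinations of monomials.
\<close>

lemma new_coframe:
  assumes "is_form 1 x1" "is_form 1 x2" "is_form 1 x3" "is_form 1 x4" "is_form 1 x5" "is_form 1 x6"
    and "x1 \<and>\<^sub>F x2 + x3 \<and>\<^sub>F x4 + x5 \<and>\<^sub>F x6 = f 1 \<and>\<^sub>F f 2 + f 3 \<and>\<^sub>F f 4 + f 5 \<and>\<^sub>F f 6"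
  shows "symplectic_coframe (sextuple x1 x2 x3 x4 x5 x6)"
  by unfold_locales (use assms symplectic in \<open>simp_all add: sextuple_def\<close>)

lemmas one_form_intros = is_form_1_linear one

text \<open>
  A common factor \<open>f\<^sup>5\<close>.  Rescaling within the conjugate pairs \<open>(f\<^sup>1, f\<^sup>2)\<close> and \<open>(f\<^sup>5, f\<^sup>6)\<close> normalises
  the absolute values of both nonzero coefficients, and one sign; the sign of \<open>a b\<close> is the invariant that
  separates \<open>O\<^sub>1\<^sup>+\<close> from \<open>O\<^sub>1\<^sup>-\<close>, and \<open>O\<^sub>3\<close> arises if just one coefficient vanishes.
\<close>

lemma real_pair_form:
  "a \<cdot> (f 1 \<and>\<^sub>F f 3 \<and>\<^sub>F f 5) + b \<cdot> (f 2 \<and>\<^sub>F f 4 \<and>\<^sub>F f 5) \<in> normal_orbits" (is "?\<phi> \<in> _")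
proof -
  consider "a = 0" "b = 0" | "a \<noteq> 0" "b = 0" | "a = 0" "b \<noteq> 0" | "a * b < 0" | "a * b > 0"
    by (metis linorder_neqE_linordered_idom mult_eq_0_iff)
  then show ?thesis
  proof cases
    case 1
    then show ?thesis by (simp add: scale_linear zero_normal)
  next
    case 2
    interpret h: symplectic_coframe "sextuple (a \<cdot> f 1) ((1 / a) \<cdot> f 2) (f 3) (f 4) (f 5) (f 6)"
      using 2 by (intro new_coframe one_form_intros) (simp add: expand)
    show ?thesis using h.normal_forms(4) 2 by (simp add: expand)
  next
    case 3
    interpret h: symplectic_coframe "sextuple (b \<cdot> f 2) (- ((1 / b) \<cdot> f 1)) (f 4) (- f 3) (f 5) (f 6)"
      using 3 by (intro new_coframe one_form_intros) (simp add: expand)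
    show ?thesis using h.normal_forms(4) 3 by (simp add: expand)
  next
    case 4
    define t where "t = sqrt (- (a * b))"
    define r where "r = a / t"
    have t: "t > 0" "t * t = - (a * b)" and "a \<noteq> 0" using 4 by (auto simp: t_def)
    then have r: "1 / r * r = 1" "1 / t * t = 1" "t * r = a" "t * (1 / r) = - b"
      by (auto simp: r_def field_simps)
    interpret h: symplectic_coframe "sextuple (r \<cdot> f 1) ((1 / r) \<cdot> f 2) (f 3) (f 4) (t \<cdot> f 5) ((1 / t) \<cdot> f 6)"
      by (intro new_coframe one_form_intros) (simp only: wedge_linear scale_linear r)
    have "(r \<cdot> f 1 \<and>\<^sub>F f 3 - (1 / r) \<cdot> f 2 \<and>\<^sub>F f 4) \<and>\<^sub>F t \<cdot> f 5
        = (t * r) \<cdot> (f 1 \<and>\<^sub>F f 3 \<and>\<^sub>F f 5) - (t * (1 / r)) \<cdot> (f 2 \<and>\<^sub>F f 4 \<and>\<^sub>F f 5)"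
      by (simp only: expand)
    also have "\<dots> = ?\<phi>" unfolding r by (simp add: fun_eq_iff scale_form_def)
    finally show ?thesis using h.normal_forms(2) by simp
  next
    case 5
    define t where "t = sqrt (a * b)"
    define r where "r = a / t"
    have t: "t > 0" "t * t = a * b" and "a \<noteq> 0" using 5 by (auto simp: t_def)
    then have r: "1 / r * r = 1" "1 / t * t = 1" "t * r = a" "t * (1 / r) = b"
      by (auto simp: r_def field_simps)
    interpret h: symplectic_coframe "sextuple (r \<cdot> f 1) ((1 / r) \<cdot> f 2) (f 3) (f 4) (t \<cdot> f 5) ((1 / t) \<cdot> f 6)"
      by (intro new_coframe one_form_intros) (simp only: wedge_linear scale_linear r)
    have "(r \<cdot> f 1 \<and>\<^sub>F f 3 + (1 / r) \<cdot> f 2 \<and>\<^sub>F f 4) \<and>\<^sub>F t \<cdot> f 5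
        = (t * r) \<cdot> (f 1 \<and>\<^sub>F f 3 \<and>\<^sub>F f 5) + (t * (1 / r)) \<cdot> (f 2 \<and>\<^sub>F f 4 \<and>\<^sub>F f 5)"
      by (simp only: expand)
    also have "\<dots> = ?\<phi>" unfolding r ..
    finally show ?thesis using h.normal_forms(3) by simp
  qed
qed

text \<open>
  Two transverse Lagrangian summands.  Here the sign of \<open>a b\<close> can be changed, by exchanging the two
  members of each conjugate pair, so only the size \<open>\<mu>\<close> remains.
\<close>

lemma transverse_pair_form:
  assumes "a \<noteq> 0" "b \<noteq> 0"
  shows "a \<cdot> (f 1 \<and>\<^sub>F f 3 \<and>\<^sub>F f 5) + b \<cdot> (f 2 \<and>\<^sub>F f 4 \<and>\<^sub>F f 6) \<in> normal_orbits" (is "?\<phi> \<in> _")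
proof -
  define \<mu> where "\<mu> = sqrt \<bar>a * b\<bar>"
  have \<mu>: "\<mu> > 0" "\<mu> * \<mu> = \<bar>a * b\<bar>" using assms by (auto simp: \<mu>_def)
  consider "a * b > 0" | "a * b < 0" using assms by (metis linorder_neqE_linordered_idom mult_eq_0_iff)
  then show ?thesis
  proof cases
    case 1
    have r: "b / \<mu> * (a / \<mu>) = 1" "\<mu> * (a / \<mu>) = a" "\<mu> * (b / \<mu>) = b"
      using \<mu> 1 assms by (simp_all add: field_simps)
    interpret h: symplectic_coframe "sextuple ((a / \<mu>) \<cdot> f 1) ((b / \<mu>) \<cdot> f 2) (f 3) (f 4) (f 5) (f 6)"
      by (intro new_coframe one_form_intros) (simp only: wedge_linear scale_linear r)
    have "\<mu> \<cdot> ((a / \<mu>) \<cdot> f 1 \<and>\<^sub>F f 3 \<and>\<^sub>F f 5 + (b / \<mu>) \<cdot> f 2 \<and>\<^sub>F f 4 \<and>\<^sub>F f 6) = ?\<phi>"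
      by (simp only: expand r)
    then show ?thesis using h.normal_forms(1)[OF \<mu>(1)] by simp
  next
    case 2
    define u v where "u = - (a / \<mu>)" and "v = b / \<mu>"
    have r: "u * v = 1" "\<mu> * v = b" "\<mu> * u = - a"
      using \<mu> 2 assms by (simp_all add: u_def v_def field_simps)
    interpret h: symplectic_coframe "sextuple (v \<cdot> f 2) (- (u \<cdot> f 1)) (f 4) (- f 3) (f 6) (- f 5)"
      by (intro new_coframe one_form_intros) (simp add: expand r)
    have "\<mu> \<cdot> (v \<cdot> f 2 \<and>\<^sub>F f 4 \<and>\<^sub>F f 6 + (- (u \<cdot> f 1)) \<and>\<^sub>F (- f 3) \<and>\<^sub>F (- f 5)) = ?\<phi>"
      by (simp add: expand r) (simp add: fun_eq_iff scale_form_def)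
    then show ?thesis using h.normal_forms(1)[OF \<mu>(1)] by simp
  qed
qed

text \<open>
  The summand \<open>\<sigma> \<and> f\<^sup>5\<close> of \<open>two_plane_form\<close>.
\<close>

definition plane_form :: "real \<Rightarrow> real \<Rightarrow> real \<Rightarrow> (real^6) form" where
  "plane_form a d p = a \<cdot> (f 1 \<and>\<^sub>F f 3 \<and>\<^sub>F f 5) + d \<cdot> (f 2 \<and>\<^sub>F f 4 \<and>\<^sub>F f 5)
     + p \<cdot> (f 1 \<and>\<^sub>F f 2 \<and>\<^sub>F f 5 - f 3 \<and>\<^sub>F f 4 \<and>\<^sub>F f 5)"

text \<open>
  Completing the square: the shear by \<open>y = p / a\<close> absorbs the mixed term into
  \<open>a (f\<^sup>1 + y f\<^sup>4) \<and> (f\<^sup>3 + y f\<^sup>2)\<close>.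
\<close>

lemma plane_form_normal_nonzero:
  assumes "a \<noteq> 0"
  shows "plane_form a d p \<in> normal_orbits"
proof -
  define y where "y = p / a"
  have p: "p = a * y" using assms by (simp add: y_def)
  interpret h: symplectic_coframe "sextuple (f 1 + y \<cdot> f 4) (f 2) (f 3 + y \<cdot> f 2) (f 4) (f 5) (f 6)"
    by (intro new_coframe one_form_intros) (simp add: expand)
  have "plane_form a d p = a \<cdot> ((f 1 + y \<cdot> f 4) \<and>\<^sub>F (f 3 + y \<cdot> f 2) \<and>\<^sub>F f 5)
     + (d + a * y * y) \<cdot> (f 2 \<and>\<^sub>F f 4 \<and>\<^sub>F f 5)"
    unfolding plane_form_def p
    by (simp add: expand) (simp add: fun_eq_iff scale_form_def algebra_simps)
  then show ?thesis using h.real_pair_form[of a "d + a * y * y"] by simp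
qed

lemma plane_form_normal: "plane_form a d p \<in> normal_orbits"
proof -
  consider "a \<noteq> 0" | "a = 0" "d \<noteq> 0" | "a = 0" "d = 0" by blast
  then show ?thesis
  proof cases
    case 1
    then show ?thesis by (rule plane_form_normal_nonzero)
  next
    case 2
    interpret h: symplectic_coframe "sextuple (f 2) (- f 1) (f 4) (- f 3) (f 5) (f 6)"
      by (intro new_coframe one_form_intros) (simp add: expand)
    have "h.plane_form d a p = plane_form a d p"
      unfolding plane_form_def h.plane_form_def by (simp add: expand)
    then show ?thesis using h.plane_form_normal_nonzero[OF 2(2)] by metis
  next
    case 3
    \<comment> \<open>Without a square to complete: \<open>f\<^sup>1\<^sup>2 - f\<^sup>3\<^sup>4\<close> is half the sum of \<open>(f\<^sup>1 + f\<^sup>4) \<and> (f\<^sup>2 + f\<^sup>3)\<close> and \<open>(f\<^sup>1 - f\<^sup>4) \<and> (f\<^sup>2 - f\<^sup>3)\<close>.\<close>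
    interpret h: symplectic_coframe
      "sextuple (f 1 + f 4) ((1/2) \<cdot> (f 2 - f 3)) (f 2 + f 3) ((1/2) \<cdot> (f 4 - f 1)) (f 5) (f 6)"
      by (intro new_coframe one_form_intros)
        (simp add: expand)
    have "plane_form a d p = (p / 2) \<cdot> ((f 1 + f 4) \<and>\<^sub>F (f 2 + f 3) \<and>\<^sub>F f 5)
       + (2 * p) \<cdot> ((1/2) \<cdot> (f 2 - f 3) \<and>\<^sub>F (1/2) \<cdot> (f 4 - f 1) \<and>\<^sub>F f 5)"
      unfolding plane_form_def 3 by (simp add: expand)
    then show ?thesis using h.real_pair_form[of "p / 2" "2 * p"] by simp
  qed
qed

text \<open>
  With \<open>s = t = 0\<close> both 2-forms are decomposable:
  \<open>\<sigma> = a (f\<^sup>1 + y f\<^sup>4) \<and> (f\<^sup>3 + y f\<^sup>2)\<close> and \<open>\<tau> = b (f\<^sup>1 - z f\<^sup>3) \<and> (f\<^sup>4 + z f\<^sup>2)\<close>, and their product is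
  \<open>- 2 a b y z\<close> times \<open>f\<^sup>1\<^sup>2\<^sup>3\<^sup>4\<close>.  If \<open>y z = 0\<close> they share a factor.
\<close>

lemma decomposable_pair_normal_nonzero_both:
  assumes "a \<noteq> 0" "b \<noteq> 0" "a * d + p\<^sup>2 = 0" "b * c = q\<^sup>2"
  shows "two_plane_form a d p b c q \<in> normal_orbits"
proof -
  define y z where "y = p / a" and "z = q / b"
  have p: "p = a * y" and q: "q = b * z" using assms by (simp_all add: y_def z_def)
  have "a * (d + a * y * y) = 0" "b * (c - b * z * z) = 0"
    using assms(3,4) by (simp_all add: p q power2_eq_square algebra_simps)
  then have d: "d = - (a * y * y)" and c: "c = b * z * z" using assms by auto
  consider "y = 0" | "z = 0" | "y \<noteq> 0" "z \<noteq> 0" by blast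
  then show ?thesis
  proof cases
    case 1
    \<comment> \<open>The common factor \<open>f\<^sup>1 - z f\<^sup>3\<close> takes the fifth place.\<close>
    interpret h: symplectic_coframe "sextuple (f 5) (f 6) (f 3) (f 4 + z \<cdot> f 2) (f 1 - z \<cdot> f 3) (f 2)"
      by (intro new_coframe one_form_intros) (simp add: expand)
    have "two_plane_form a d p b c q = (- a) \<cdot> (f 5 \<and>\<^sub>F f 3 \<and>\<^sub>F (f 1 - z \<cdot> f 3))
        + (- b) \<cdot> (f 6 \<and>\<^sub>F (f 4 + z \<cdot> f 2) \<and>\<^sub>F (f 1 - z \<cdot> f 3))"
      unfolding two_plane_form_def p q d c 1
      by (simp add: expand) (simp add: fun_eq_iff scale_form_def algebra_simps)
    then show ?thesis using h.real_pair_form[of "- a" "- b"] by simp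
  next
    case 2
    \<comment> \<open>The common factor \<open>f\<^sup>1 + y f\<^sup>4\<close> takes the fifth place.\<close>
    interpret h: symplectic_coframe "sextuple (f 5) (f 6) (f 3 + y \<cdot> f 2) (f 4) (f 1 + y \<cdot> f 4) (f 2)"
      by (intro new_coframe one_form_intros) (simp add: expand)
    have "two_plane_form a d p b c q = (- a) \<cdot> (f 5 \<and>\<^sub>F (f 3 + y \<cdot> f 2) \<and>\<^sub>F (f 1 + y \<cdot> f 4))
        + (- b) \<cdot> (f 6 \<and>\<^sub>F f 4 \<and>\<^sub>F (f 1 + y \<cdot> f 4))"
      unfolding two_plane_form_def p q d c 2
      by (simp add: expand) (simp add: fun_eq_iff scale_form_def algebra_simps)
    then show ?thesis using h.real_pair_form[of "- a" "- b"] by simp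
  next
    case 3
    \<comment> \<open>The second and fourth members span the plane of \<open>\<tau>\<close>, in the basis conjugate to that of \<open>\<sigma>\<close>.\<close>
    let ?x = "f 1 - z \<cdot> f 3" and ?w = "f 4 + z \<cdot> f 2"
    interpret h: symplectic_coframe "sextuple (f 1 + y \<cdot> f 4) ((1 / (2 * y * z)) \<cdot> (?x + y \<cdot> ?w))
        (f 3 + y \<cdot> f 2) ((1 / (2 * y)) \<cdot> (y \<cdot> ?w - ?x)) (f 5) (f 6)"
      using 3 by (intro new_coframe one_form_intros)
        (simp add: expand)
    have "two_plane_form a d p b c q = a \<cdot> ((f 1 + y \<cdot> f 4) \<and>\<^sub>F (f 3 + y \<cdot> f 2) \<and>\<^sub>F f 5)
        + (2 * b * y * z) \<cdot> ((1 / (2 * y * z)) \<cdot> (?x + y \<cdot> ?w) \<and>\<^sub>F (1 / (2 * y)) \<cdot> (y \<cdot> ?w - ?x) \<and>\<^sub>F f 6)"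
      unfolding two_plane_form_def p q d c using 3
      by (simp add: expand) (simp add: fun_eq_iff scale_form_def field_simps)
    then show ?thesis using h.transverse_pair_form[of a "2 * b * y * z"] assms 3 by simp
  qed
qed

text \<open>
  Exchanging the first two conjugate pairs interchanges \<open>b\<close> and \<open>c\<close> up to sign and fixes \<open>a, d\<close> up to sign.
\<close>

lemma decomposable_pair_normal_nonzero:
  assumes "a \<noteq> 0" "b \<noteq> 0 \<or> c \<noteq> 0" "a * d + p\<^sup>2 = 0" "b * c = q\<^sup>2"
  shows "two_plane_form a d p b c q \<in> normal_orbits"
proof (cases "b = 0")
  case False
  then show ?thesis using assms decomposable_pair_normal_nonzero_both by blast
next
  case True
  interpret h: symplectic_coframe "sextuple (f 3) (f 4) (f 1) (f 2) (f 5) (f 6)"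
    by (intro new_coframe one_form_intros) simp
  have "h.two_plane_form (- a) (- d) (- p) (- c) (- b) (- q) = two_plane_form a d p b c q"
    unfolding two_plane_form_def h.two_plane_form_def
    by (simp add: expand) (simp add: fun_eq_iff scale_form_def algebra_simps)
  moreover have "h.two_plane_form (- a) (- d) (- p) (- c) (- b) (- q) \<in> normal_orbits"
    by (rule h.decomposable_pair_normal_nonzero_both) (use True assms in \<open>auto simp: mult.commute\<close>)
  ultimately show ?thesis by simp
qed

text \<open>
  Exchanging the members within the first two conjugate pairs interchanges \<open>a\<close> and \<open>d\<close>.
\<close>

lemma decomposable_pair_normal:
  assumes "a \<noteq> 0 \<or> d \<noteq> 0" "b \<noteq> 0 \<or> c \<noteq> 0" "a * d + p\<^sup>2 = 0" "b * c = q\<^sup>2"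
  shows "two_plane_form a d p b c q \<in> normal_orbits"
proof (cases "a = 0")
  case False
  then show ?thesis using assms decomposable_pair_normal_nonzero by blast
next
  case True
  interpret h: symplectic_coframe "sextuple (f 2) (- f 1) (f 4) (- f 3) (f 5) (f 6)"
    by (intro new_coframe one_form_intros) (simp add: expand)
  have "h.two_plane_form d a p (- c) (- b) q = two_plane_form a d p b c q"
    unfolding two_plane_form_def h.two_plane_form_def
    by (simp add: expand) (simp add: fun_eq_iff scale_form_def algebra_simps)
  moreover have "h.two_plane_form d a p (- c) (- b) q \<in> normal_orbits"
    by (rule h.decomposable_pair_normal_nonzero) (use True assms in \<open>auto simp: mult.commute\<close>)
  ultimately show ?thesis by simp
qed

text \<open>
  The equations make \<open>s\<close> vanish unless \<open>b = c = 0\<close>, and \<open>t\<close> unless \<open>a = d = 0\<close>.  If \<open>b = c = 0\<close> and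
  \<open>t = 0\<close>, then \<open>q = 0\<close> and \<open>\<tau>\<close> disappears; likewise for \<open>\<sigma>\<close>.
\<close>

lemma two_plane_normal:
  assumes "(a * d + p\<^sup>2) * b = 0" "(a * d + p\<^sup>2) * c = 0" "(b * c - q\<^sup>2) * a = 0" "(b * c - q\<^sup>2) * d = 0"
  shows "two_plane_form a d p b c q \<in> normal_orbits"
proof -
  consider "a = 0" "d = 0" "b = 0" "c = 0" | "a \<noteq> 0 \<or> d \<noteq> 0" "b = 0" "c = 0" "q = 0"
    | "a = 0" "d = 0" "b \<noteq> 0 \<or> c \<noteq> 0" "p = 0"
    | "a \<noteq> 0 \<or> d \<noteq> 0" "b \<noteq> 0 \<or> c \<noteq> 0" "a * d + p\<^sup>2 = 0" "b * c = q\<^sup>2"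
  proof -
    have "b = 0 \<and> c = 0 \<or> a * d + p\<^sup>2 = 0" "a = 0 \<and> d = 0 \<or> b * c = q\<^sup>2"
      using assms by auto
    moreover have "p = 0" if "a = 0" "a * d + p\<^sup>2 = 0" using that by simp
    moreover have "q = 0" if "b = 0" "b * c = q\<^sup>2" using that by simp
    ultimately show thesis using that by blast
  qed
  then show ?thesis
  proof cases
    case 1
    show ?thesis
    proof (cases "p\<^sup>2 + q\<^sup>2 = 0")
      case True
      then have "p = 0" "q = 0" by (simp_all add: sum_power2_eq_zero_iff)
      then show ?thesis using 1 by (simp add: two_plane_form_def scale_linear zero_normal)
    next
      case False
      define r where "r = 1 / (p\<^sup>2 + q\<^sup>2)"
      have r: "r * (p * p) + r * (q * q) = 1"
      proof -
        have "r * (p\<^sup>2 + q\<^sup>2) = 1" using False by (simp add: r_def)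
        then show ?thesis by (simp add: power2_eq_square algebra_simps)
      qed
      \<comment> \<open>Both 2-forms are multiples of \<open>f\<^sup>1\<^sup>2 - f\<^sup>3\<^sup>4\<close>; the 1-form \<open>p f\<^sup>5 + q f\<^sup>6\<close> becomes the fifth member.\<close>
      interpret h: symplectic_coframe
        "sextuple (f 1) (f 2) (f 3) (f 4) (p \<cdot> f 5 + q \<cdot> f 6) (r \<cdot> (p \<cdot> f 6 - q \<cdot> f 5))"
      proof (intro new_coframe one_form_intros)
        have "(p \<cdot> f 5 + q \<cdot> f 6) \<and>\<^sub>F (r \<cdot> (p \<cdot> f 6 - q \<cdot> f 5)) = (r * (p * p) + r * (q * q)) \<cdot> (f 5 \<and>\<^sub>F f 6)"
          by (simp add: expand) (simp add: fun_eq_iff scale_form_def algebra_simps)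
        then show "f 1 \<and>\<^sub>F f 2 + f 3 \<and>\<^sub>F f 4 + (p \<cdot> f 5 + q \<cdot> f 6) \<and>\<^sub>F (r \<cdot> (p \<cdot> f 6 - q \<cdot> f 5))
            = f 1 \<and>\<^sub>F f 2 + f 3 \<and>\<^sub>F f 4 + f 5 \<and>\<^sub>F f 6"
          by (simp add: r scale_linear)
      qed
      have "h.plane_form 0 0 1 = two_plane_form a d p b c q"
        unfolding two_plane_form_def h.plane_form_def 1 by (simp add: expand)
      then show ?thesis using h.plane_form_normal[of 0 0 1] by simp
    qed
  next
    case 2
    then have "two_plane_form a d p b c q = plane_form a d p"
      by (simp add: two_plane_form_def plane_form_def scale_linear)
    then show ?thesis using plane_form_normal by simp
  next
    case 3
    \<comment> \<open>This change of coframe turns \<open>\<tau> \<and> f\<^sup>6\<close> into a form of the type \<open>\<sigma> \<and> f\<^sup>5\<close>.\<close>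
    interpret h: symplectic_coframe "sextuple (f 1) (f 2) (f 4) (- f 3) (f 6) (- f 5)"
      by (intro new_coframe one_form_intros) (simp add: expand)
    have "h.plane_form b (- c) q = two_plane_form a d p b c q"
      unfolding two_plane_form_def h.plane_form_def 3 by (simp add: expand) (simp add: fun_eq_iff scale_form_def)
    then show ?thesis using h.plane_form_normal[of b "- c" q] by simp
  next
    case 4
    then show ?thesis by (rule decomposable_pair_normal)
  qed
qed

end

section \<open>The classification\<close>

theorem proposition5p5:
  fixes \<phi> :: "(real^6) dform"
    and A B C D E F G H I J K L M N :: real
  assumes "\<And>x. is_form 3 (\<phi> x)"
    and "left_invariant \<phi>"
    and "primitive \<phi>"
    and "\<phi> = (\<lambda>x.
      A \<cdot> cof3 1 3 5 x + B \<cdot> cof3 1 3 6 x + C \<cdot> cof3 1 4 5 x + D \<cdot> cof3 1 4 6 x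
      + E \<cdot> cof3 2 3 5 x + F \<cdot> cof3 2 3 6 x + G \<cdot> cof3 2 4 5 x + H \<cdot> cof3 2 4 6 x
      + (I \<cdot> cof 1 x + J \<cdot> cof 2 x) \<and>\<^sub>F (cof2 3 4 x - cof2 5 6 x)
      + (K \<cdot> cof 3 x + L \<cdot> cof 4 x) \<and>\<^sub>F (cof2 1 2 x - cof2 5 6 x)
      + (M \<cdot> cof 5 x + N \<cdot> cof 6 x) \<and>\<^sub>F (cof2 1 2 x - cof2 3 4 x))"
  shows
    "(integrable_form \<phi> \<longleftrightarrow>
        (\<exists>\<alpha> \<beta> \<gamma> \<delta>. A = \<alpha> \<and> B = \<alpha> \<and> C = \<beta> \<and> - D = \<beta> \<and> E = \<gamma> \<and> - F = \<gamma> \<and> G = - \<delta> \<and> H = - \<delta>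
           \<and> I = 0 \<and> J = 0 \<and> K = 0 \<and> L = 0))
   \<and> (integrable_form \<phi> \<and> stationary \<phi> \<longleftrightarrow> integrable_form \<phi> \<and> F_integrable \<phi>)
   \<and> (integrable_form \<phi> \<and> stationary \<phi> \<longrightarrow>
        (\<exists>\<alpha> \<beta> \<gamma> \<delta>. A = \<alpha> \<and> B = \<alpha> \<and> C = \<beta> \<and> - D = \<beta> \<and> E = \<gamma> \<and> - F = \<gamma> \<and> G = - \<delta> \<and> H = - \<delta>
           \<and> I = 0 \<and> J = 0 \<and> K = 0 \<and> L = 0
           \<and> \<alpha> * (4 * \<beta> * \<gamma> - (M - N)\<^sup>2) = 0
           \<and> \<delta> * (4 * \<beta> * \<gamma> - (M - N)\<^sup>2) = 0
           \<and> \<beta> * (4 * \<alpha> * \<delta> - (M + N)\<^sup>2) = 0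
           \<and> \<gamma> * (4 * \<alpha> * \<delta> - (M + N)\<^sup>2) = 0
           \<and> (\<forall>x. Q_fun \<phi> x = 64 * \<alpha> * \<beta> * \<gamma> * \<delta>)
           \<and> 64 * \<alpha> * \<beta> * \<gamma> * \<delta> \<ge> 0))
   \<and> (integrable_form \<phi> \<and> F_integrable \<phi> \<longrightarrow>
        (\<exists>\<mu>>0. \<phi> 0 \<in> O_plus \<mu>) \<or> \<phi> 0 \<in> O1_plus \<or> \<phi> 0 \<in> O1_minus \<or> \<phi> 0 \<in> O3_prim \<or> \<phi> 0 \<in> O6)"
proof -
  have phi: "\<phi> = general_form A B C D E F G H I J K L M N"
    unfolding assms(4) general_form_def ..
  have integrable: "integrable_form \<phi> \<longleftrightarrow>
      B = A \<and> D = - C \<and> F = - E \<and> G = H \<and> I = 0 \<and> J = 0 \<and> K = 0 \<and> L = 0"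
    unfolding phi by (rule integrable_general_form)
  define \<delta> where "\<delta> = - H"
  define p q where "p = (M + N) / 2" and "q = N - M"
  define s t where "s = A * (- \<delta>) + p\<^sup>2" and "t = (- 2 * C) * (- 2 * E) - q\<^sup>2"
  have s: "4 * s = - (4 * A * \<delta> - (M + N)\<^sup>2)" and t: "t = 4 * C * E - (M - N)\<^sup>2"
    by (simp_all add: s_def t_def p_def q_def power2_eq_square field_simps)
  {
    assume i: "integrable_form \<phi>"
    have two_plane: "\<phi> x = frame.two_plane_form x A (- \<delta>) p (- 2 * C) (- 2 * E) q" for x
      using i closed_general_form[of A C E \<delta> M N x] unfolding integrable
      by (simp add: phi \<delta>_def p_def q_def)
    note two_plane_facts = two_plane s_def t_def
    let ?eqs = "A * t = 0 \<and> \<delta> * t = 0 \<and> C * (4 * s) = 0 \<and> E * (4 * s) = 0"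
    have stationary: "stationary \<phi> \<longleftrightarrow> ?eqs" and F_integrable: "F_integrable \<phi> \<longleftrightarrow> ?eqs"
      unfolding stationary_iff[OF two_plane_facts] F_integrable_iff[OF two_plane_facts] by auto
    have Q: "Q_fun \<phi> x = 64 * A * C * E * \<delta>" "64 * A * C * E * \<delta> \<ge> 0" if ?eqs for x
    proof -
      \<comment> \<open>By the equations \<open>\<beta> \<gamma> P\<close> and \<open>\<alpha> \<delta> R\<close> are both \<open>4 X\<close>, hence \<open>X P R = 16 X\<^sup>2\<close> with \<open>P R \<ge> 0\<close>.\<close>
      define P R X where "P = (M + N)\<^sup>2" and "R = (M - N)\<^sup>2" and "X = A * C * E * \<delta>"
      have "C * P = 4 * A * C * \<delta>" "A * R = 4 * A * C * E"
        using that unfolding s t P_def R_def by (auto simp: algebra_simps)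
      then have PR: "C * E * P = 4 * X" "A * \<delta> * R = 4 * X"
        unfolding X_def by (metis mult.assoc mult.commute)+
      have "Q_fun \<phi> x = 16 * ((p * q)\<^sup>2 + s * t)"
        by (rule Q_fun_eq[OF two_plane_facts])
      also have "\<dots> = 16 * (C * E * P + A * \<delta> * R - 4 * X)"
        by (simp add: s_def t_def p_def q_def P_def R_def X_def power2_eq_square field_simps)
      finally show "Q_fun \<phi> x = 64 * A * C * E * \<delta>" unfolding PR by (simp add: X_def)
      have "X * (P * R) = (C * E * P) * (A * \<delta> * R)" by (simp add: X_def)
      then have "X * (P * R) = 16 * (X * X)" unfolding PR by simp
      then have "X = 0 \<or> P * R = 16 * X" by auto
      moreover have "P * R \<ge> 0" by (simp add: P_def R_def)
      ultimately have "X \<ge> 0" by auto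
      then show "64 * A * C * E * \<delta> \<ge> 0" by (simp add: X_def)
    qed
    have "\<phi> 0 \<in> normal_orbits" if ?eqs
      unfolding two_plane
      by (rule frame.two_plane_normal) (use that in \<open>auto simp: s_def t_def\<close>)
    note stationary F_integrable Q this
  }
  note closed = this
  have orbits: "\<phi> 0 \<in> normal_orbits \<Longrightarrow>
      (\<exists>\<mu>>0. \<phi> 0 \<in> O_plus \<mu>) \<or> \<phi> 0 \<in> O1_plus \<or> \<phi> 0 \<in> O1_minus \<or> \<phi> 0 \<in> O3_prim \<or> \<phi> 0 \<in> O6"
    by (auto simp: normal_orbits_def)
  show ?thesis
  proof (intro conjI impI)
    show "integrable_form \<phi> \<longleftrightarrow>
        (\<exists>\<alpha> \<beta> \<gamma> \<delta>. A = \<alpha> \<and> B = \<alpha> \<and> C = \<beta> \<and> - D = \<beta> \<and> E = \<gamma> \<and> - F = \<gamma> \<and> G = - \<delta> \<and> H = - \<delta>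
           \<and> I = 0 \<and> J = 0 \<and> K = 0 \<and> L = 0)"
      unfolding integrable by (auto intro: exI[of _ "- H"])
    show "integrable_form \<phi> \<and> stationary \<phi> \<longleftrightarrow> integrable_form \<phi> \<and> F_integrable \<phi>"
      using closed(1,2) by blast
  next
    assume *: "integrable_form \<phi> \<and> stationary \<phi>"
    have "A = A \<and> B = A \<and> C = C \<and> - D = C \<and> E = E \<and> - F = E \<and> G = - \<delta> \<and> H = - \<delta>
           \<and> I = 0 \<and> J = 0 \<and> K = 0 \<and> L = 0
           \<and> A * (4 * C * E - (M - N)\<^sup>2) = 0
           \<and> \<delta> * (4 * C * E - (M - N)\<^sup>2) = 0
           \<and> C * (4 * A * \<delta> - (M + N)\<^sup>2) = 0
           \<and> E * (4 * A * \<delta> - (M + N)\<^sup>2) = 0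
           \<and> (\<forall>x. Q_fun \<phi> x = 64 * A * C * E * \<delta>)
           \<and> 64 * A * C * E * \<delta> \<ge> 0"
      using * closed(1,3,4) unfolding integrable s t by (auto simp: \<delta>_def)
    then show "\<exists>\<alpha> \<beta> \<gamma> \<delta>. A = \<alpha> \<and> B = \<alpha> \<and> C = \<beta> \<and> - D = \<beta> \<and> E = \<gamma> \<and> - F = \<gamma> \<and> G = - \<delta> \<and> H = - \<delta>
           \<and> I = 0 \<and> J = 0 \<and> K = 0 \<and> L = 0
           \<and> \<alpha> * (4 * \<beta> * \<gamma> - (M - N)\<^sup>2) = 0
           \<and> \<delta> * (4 * \<beta> * \<gamma> - (M - N)\<^sup>2) = 0
           \<and> \<beta> * (4 * \<alpha> * \<delta> - (M + N)\<^sup>2) = 0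
           \<and> \<gamma> * (4 * \<alpha> * \<delta> - (M + N)\<^sup>2) = 0
           \<and> (\<forall>x. Q_fun \<phi> x = 64 * \<alpha> * \<beta> * \<gamma> * \<delta>)
           \<and> 64 * \<alpha> * \<beta> * \<gamma> * \<delta> \<ge> 0"
      by (intro exI)
  next
    assume "integrable_form \<phi> \<and> F_integrable \<phi>"
    then show "(\<exists>\<mu>>0. \<phi> 0 \<in> O_plus \<mu>) \<or> \<phi> 0 \<in> O1_plus \<or> \<phi> 0 \<in> O1_minus \<or> \<phi> 0 \<in> O3_prim \<or> \<phi> 0 \<in> O6"
      using closed(2,5) by (intro orbits) blast
  qed
qed

end
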